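(* Let $0<\rho\leq\infty$ and $I=(0,\rho)$. Fix an integer $n\geq 2$ and a real number $M>n-2$. Let $\mu$ be a finite positive Borel measure on $\mathbb{R}$ with compact support contained in $\mathcal{A}_n\cap[0,M)$, and suppose that $\operatorname{supp}\mu$ contains at least $n$ distinct points. Let $$F_\mu(x):=\int_{\mathbb{R}}x^\alpha\,\mathrm{d}\mu(\alpha),\qquad G_\mu(x):=\int_{\mathbb{R}}x^\alpha v_\alpha v_\alpha^\top\,\mathrm{d}\mu(\alpha)\qquad (x>0).$$ Set $$c_*(\mu,M;I)=\begin{cases}\dfrac{1}{\rho^M\,v_M^\top G_\mu(\rho)^{-1}v_M}, & 0<\rho<\infty,\\[2mm] 0, & \rho=\infty.\end{cases}$$ Then, for $c\in\mathbb{R}$, the function $x\mapsto F_\mu(x)-cx^M$ preserves positivity on $\mathbb{P}_n(I)$ if and only if $c\leq c_*(\mu,M;I)$.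
   Context: $\mathcal{A}_n:=\mathbb{N}_0\cup[n-2,\infty)$ with $\mathbb{N}_0=\{0,1,2,\ldots\}$, and $v_\alpha:=(1,\alpha,\ldots,\alpha^{n-1})^\top\in\mathbb{R}^n$ for $\alpha\in\mathbb{R}$. $\mathbb{P}_n(I)$ denotes the set of real symmetric positive semidefinite $n\times n$ matrices all of whose entries lie in $I$. A function $f:I\to\mathbb{R}$ preserves positivity on $\mathbb{P}_n(I)$ if the entrywise image $f[A]=[f(a_{ij})]$ is positive semidefinite for every $A\in\mathbb{P}_n(I)$. (Under the hypotheses, $G_\mu(x)$ is positive definite for every $x>0$, so the inverse in the definition of $c_*$ makes sense.) *)

theory Defs
  imports "HOL-Analysis.Analysis" "Jordan_Normal_Form.Gauss_Jordan_Elimination"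
begin

(* Both HOL-Analysis and Jordan_Normal_Form.Matrix provide the constants vec and mat and
   the infix symbols for indexing and scalar products; the dimension n varies as a natural
   number here, so the latter are meant throughout (indices run over {0..<n}). *)
no_notation inner (infix "\<bullet>" 70)
no_notation vec_nth (infixl "$" 90)

definition pos_semidef :: "real mat \<Rightarrow> bool" where
  "pos_semidef A \<longleftrightarrow> square_mat A \<and> transpose_mat A = A \<and>
     (\<forall>v \<in> carrier_vec (dim_row A). 0 \<le> v \<bullet> (A *\<^sub>v v))"

definition psd_matrices :: "nat \<Rightarrow> real set \<Rightarrow> real mat set" where
  "psd_matrices n I = {A \<in> carrier_mat n n. pos_semidef A \<and> elements_mat A \<subseteq> I}"

(* f stands for a function on I; its values outside I are never used. *)
definition preserves_positivity :: "nat \<Rightarrow> real set \<Rightarrow> (real \<Rightarrow> real) \<Rightarrow> bool" where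
  "preserves_positivity n I f \<longleftrightarrow> (\<forall>A \<in> psd_matrices n I. pos_semidef (map_mat f A))"

definition measure_support :: "'a::topological_space measure \<Rightarrow> 'a set" where
  "measure_support \<mu> = {x. \<forall>U. open U \<and> x \<in> U \<longrightarrow> 0 < emeasure \<mu> U}"

definition exponents :: "nat \<Rightarrow> real set" where
  "exponents n = \<nat> \<union> {real n - 2..}"

(* The convention 0 ^ 0 = 1 makes the first entry 1 also for \<alpha> = 0. *)
definition power_vec :: "nat \<Rightarrow> real \<Rightarrow> real vec" where
  "power_vec n \<alpha> = vec n (\<lambda>i. \<alpha> ^ i)"

definition F_fun :: "real measure \<Rightarrow> real \<Rightarrow> real" where
  "F_fun \<mu> x = (LINT \<alpha>|\<mu>. x powr \<alpha>)"

(* The matrix-valued integral is taken entrywise; the (i, j) entry of v v\<^sup>T is v $ i * v $ j. *)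
definition G_mat :: "nat \<Rightarrow> real measure \<Rightarrow> real \<Rightarrow> real mat" where
  "G_mat n \<mu> x =
     mat n n (\<lambda>(i, j). LINT \<alpha>|\<mu>. x powr \<alpha> * (power_vec n \<alpha> $ i * power_vec n \<alpha> $ j))"

(* mat_inverse returns None for singular matrices; G_mat n \<mu> r is positive definite for r > 0
   as soon as the support of \<mu> has at least n points, so the option is then a Some. *)
definition c_star :: "nat \<Rightarrow> real measure \<Rightarrow> real \<Rightarrow> ereal \<Rightarrow> real" where
  "c_star n \<mu> M \<rho> =
     (if \<rho> = \<infinity> then 0
      else let r = real_of_ereal \<rho>; v = power_vec n M in
        1 / (r powr M * (v \<bullet> (the (mat_inverse (G_mat n \<mu> r)) *\<^sub>v v))))"

end

(*
If g(alpha) = rho^(alpha/2) p(alpha), p a polynomial of degree less than n, is replaced by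
g(alpha) = sum z_i u_i^alpha with 0 < u_i < sqrt rho, then the best constant C in
  C g(M)^2 <= integral of g^2 d mu
can only grow.  To see this, take the reproducing element k of evaluation at M in the span of the
u_i^alpha.  By orthogonality it has a maximal number of sign changes below M.  The function
rho^(alpha/2) q(alpha), where the polynomial q has the same zeros and agrees with k at M, is then
dominated by k on (-infinity, M]: trade the exponentials for powers of alpha one at a time, and
count zeros of the differences.  Hence the matrix inequality at rho, which is the inequality for
polynomials, gives positivity on rank-one matrices; all other matrices follow by the
FitzGerald-Horn induction, which integrates the derivative along a segment that starts at a
rank-one matrix.  Conversely, rank-one matrices u u^T with u tending to sqrt rho (1, ..., 1) recover
the inequality for polynomials, and it is equivalent to c <= c_star by Cauchy-Schwarz.
*)

theory Submission
  imports Defs "Jordan_Normal_Form.Determinant"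
begin

section \<open>Zeros of exponential polynomials\<close>

text \<open>For A = u u^T the form sum z_i z_j f(u_i u_j) equals the integral of g^2 d mu minus c
  g(M)^2, where g(alpha) = sum z_i u_i^alpha; this is why an inequality for g decides positivity.
  Writing u_i = sqrt(rho) exp(l_i) pulls out rho^(alpha/2) and leaves frequencies l_i < 0. Their
  strict negativity lets the top power dominate at infinity, and that fixes the signs when
  exponentials are traded for powers. The obstacle is that the induction on the size needs the same
  inequality for derivatives of f. The k-th derivative meets forms of size n - k and carries the
  weight a(a-1)...(a-k+1), so the extrapolation is proved for a general weight that is nonnegative
  on the support. The set of admissible exponents makes this weight nonnegative for all k < n. The
  weight vanishes at k points, so n - k of n support points survive, as many as there are
  exponentials, and the weighted inner product stays definite.\<close>

lemma Rolle_finite: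
  fixes f f' :: "real \<Rightarrow> real"
  assumes "finite S" and "\<And>x. (f has_real_derivative f' x) (at x)" and "\<And>x. x \<in> S \<Longrightarrow> f x = 0"
  shows "\<exists>T. finite T \<and> T \<inter> S = {} \<and> card S \<le> card T + 1 \<and> (\<forall>x\<in>T. f' x = 0) \<and>
    (\<forall>x\<in>T. \<exists>s\<in>S. x < s)"
  using assms(1,3)
proof (induction S rule: finite_linorder_max_induct)
  case empty
  then show ?case by (intro exI[of _ "{}"]) auto
next
  case (insert b S)
  then obtain T where T: "finite T" "T \<inter> S = {}" "card S \<le> card T + 1" "\<forall>x\<in>T. f' x = 0"
    "\<forall>x\<in>T. \<exists>s\<in>S. x < s" by auto
  \<comment> \<open>That each point of \<open>T\<close> lies below some point of \<open>S\<close> is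
    an induction invariant: it separates \<open>T\<close> from \<open>b\<close> and from the new
    Rolle point, which lies between \<open>Max S\<close> and \<open>b\<close>.\<close>
  have bT: "b \<notin> T" using T(5) insert.hyps by fastforce
  show ?case
  proof (cases "S = {}")
    case True
    then show ?thesis using T bT by (intro exI[of _ "{}"]) auto
  next
    case False
    define a where "a = Max S"
    have a: "a \<in> S" "\<And>s. s \<in> S \<Longrightarrow> s \<le> a"
      using False insert.hyps by (auto simp: a_def)
    have "a < b" using a insert.hyps by auto
    then obtain z where z: "a < z" "z < b" "f' z = 0"
      using Rolle_deriv[of a b f "\<lambda>x. (*) (f' x)"] insert.prems a assms(2)
      by (metis DERIV_continuous_on DERIV_subset has_field_derivative_def insertCI mult.commute mult_1 mult_cancel_right2 subset_UNIV)
    have "z \<notin> T" using T(5) a z by fastforce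
    moreover have "z \<notin> S" using a z by fastforce
    ultimately show ?thesis
      using T z bT insert.hyps by (intro exI[of _ "insert z T"]) (auto simp: card_insert_if)
  qed
qed

text \<open>The polynomial is the contribution of frequency 0 with multiplicity, hence the recurring
  hypothesis \<open>0 \<notin> L\<close>. As \<open>L\<close> is a set, equal frequencies have to be
  merged before this form applies.\<close>

definition exp_poly :: "real poly \<Rightarrow> (real \<Rightarrow> real) \<Rightarrow> real set \<Rightarrow> real \<Rightarrow> real" where
  "exp_poly p c L x = poly p x + (\<Sum>l\<in>L. c l * exp (l * x))"

lemma exp_poly_DERIV:
  "(exp_poly p c L has_real_derivative exp_poly (pderiv p) (\<lambda>l. l * c l) L x) (at x)"
  unfolding exp_poly_def by (auto intro!: derivative_eq_intros sum.cong)

lemma continuous_on_exp_poly [continuous_intros]: "continuous_on A (exp_poly p c L)"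
  by (meson DERIV_continuous_on DERIV_subset exp_poly_DERIV subset_UNIV)

text \<open>The set \<open>D\<close> prescribes zeros of the derivative at zeros of the function, which count twice.\<close>
lemma exp_poly_zeros:
  assumes "finite L" "0 \<notin> L" "\<forall>i\<ge>d. coeff p i = 0"
    and "finite S" "\<forall>x\<in>S. exp_poly p c L x = 0"
    and "D \<subseteq> S" "\<forall>x\<in>D. exp_poly (pderiv p) (\<lambda>l. l * c l) L x = 0"
    and "d + card L \<le> card S + card D"
  shows "p = 0 \<and> (\<forall>l\<in>L. c l = 0)"
  using assms
proof (induction "d + card L" arbitrary: d p c L S D)
  case 0
  then show ?case by (simp add: poly_eq_iff)
next
  case (Suc k)
  have DS: "finite D" using Suc.prems finite_subset by blast
  have S0: "S \<noteq> {}" using Suc.prems Suc.hyps(2) by auto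
  then obtain s0 where s0: "s0 \<in> S" by blast
  show ?case
  proof (cases d)
    case (Suc e)
    obtain T where T: "finite T" "T \<inter> S = {}" "card S \<le> card T + 1"
      "\<forall>x\<in>T. exp_poly (pderiv p) (\<lambda>l. l * c l) L x = 0"
      using Rolle_finite[OF \<open>finite S\<close> exp_poly_DERIV] Suc.prems by metis
    \<comment> \<open>The Rolle points avoid \<open>S\<close> while \<open>D\<close> lies inside it,
      so the derivative has \<open>card T + card D\<close> zeros, at most one fewer than the zeros
      of the function counted with \<open>D\<close>. The double zeros are used up here, and the
      induction continues with \<open>D = {}\<close>.\<close>
    have "pderiv p = 0 \<and> (\<forall>l\<in>L. l * c l = 0)"
    proof (rule Suc.hyps(1)[of e L "pderiv p" "T \<union> D" "\<lambda>l. l * c l" "{}"])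
      have "card (T \<union> D) = card T + card D"
        using T Suc.prems DS by (intro card_Un_disjoint) auto
      then show "e + card L \<le> card (T \<union> D) + card {}" using Suc.prems Suc T by auto
      show "\<forall>i\<ge>e. coeff (pderiv p) i = 0" using Suc.prems Suc by (simp add: coeff_pderiv)
    qed (use Suc.hyps(2) Suc.prems Suc T DS in auto)
    then have p: "pderiv p = 0" and c: "\<forall>l\<in>L. c l = 0" using Suc.prems(2) by auto
    have "poly p s0 = 0" using Suc.prems(5) s0 c by (auto simp: exp_poly_def)
    with p have "p = 0"
      by (metis degree_eq_zeroE mult.commute mult_zero_left pCons_0_0 pderiv_eq_0_iff poly_pCons poly_0 add.right_neutral)
    with c show ?thesis by simp
  next
    case 0
    then have p: "p = 0" using Suc.prems by (simp add: poly_eq_iff)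
    have "card L \<noteq> 0" using Suc.hyps(2) 0 by simp
    then obtain l0 where l0: "l0 \<in> L" by (metis card.empty ex_in_conv)
    \<comment> \<open>With no polynomial left, multiplying by \<open>exp (- l0 * x)\<close> shifts
      frequency \<open>l0\<close> to 0 and keeps the zeros. Its term becomes a constant, which
      differentiation removes, so one frequency disappears.\<close>
    define L' where "L' = (\<lambda>l. l - l0) ` (L - {l0})"
    define c' where "c' = (\<lambda>l. c (l + l0))"
    have "card L' = card (L - {l0})" unfolding L'_def by (intro card_image) (auto simp: inj_on_def)
    then have fL': "finite L'" "0 \<notin> L'" "card L = Suc (card L')"
      using Suc.prems(1) card.remove[OF Suc.prems(1) l0] by (auto simp del: card_Diff_singleton card_Diff_insert simp add: L'_def)
    have eq: "exp_poly [:c l0:] c' L' x = exp (- l0 * x) * exp_poly p c L x" for x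
    proof -
      have "(\<Sum>l\<in>L'. c' l * exp (l * x)) = (\<Sum>l\<in>L - {l0}. exp (- l0 * x) * (c l * exp (l * x)))"
        unfolding L'_def by (subst sum.reindex)
          (auto simp: inj_on_def c'_def mult_exp_exp algebra_simps intro!: sum.cong)
      moreover have "(\<Sum>l\<in>L. c l * exp (l * x)) = c l0 * exp (l0 * x) + (\<Sum>l\<in>L - {l0}. c l * exp (l * x))"
        using Suc.prems l0 by (simp add: sum.remove)
      ultimately show ?thesis
        by (simp add: exp_poly_def p sum_distrib_left distrib_left mult_exp_exp algebra_simps)
    qed
    let ?q = "\<lambda>x. exp_poly 0 (\<lambda>l. l * c' l) L' x"
    have der: "(exp_poly [:c l0:] c' L' has_real_derivative ?q x) (at x)" for x
      using exp_poly_DERIV[of "[:c l0:]" c' L' x] by (simp add: pderiv_pCons)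
    \<comment> \<open>This form shows that \<open>?q\<close> vanishes on \<open>D\<close>, where
      both the function and its derivative vanish.\<close>
    have q: "?q x = exp (- l0 * x) * (exp_poly (pderiv p) (\<lambda>l. l * c l) L x - l0 * exp_poly p c L x)" for x
    proof -
      have "exp_poly [:c l0:] c' L' = (\<lambda>x. exp (- l0 * x) * exp_poly p c L x)"
        using eq by blast
      moreover have "((\<lambda>x. exp (- l0 * x) * exp_poly p c L x) has_real_derivative
        exp (- l0 * x) * (exp_poly (pderiv p) (\<lambda>l. l * c l) L x - l0 * exp_poly p c L x)) (at x)"
        by (auto intro!: derivative_eq_intros exp_poly_DERIV simp: algebra_simps)
      ultimately show ?thesis using DERIV_unique der by metis
    qed
    have zS: "exp_poly [:c l0:] c' L' x = 0" if "x \<in> S" for x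
      using that Suc.prems(5) by (simp add: eq)
    obtain T where T: "finite T" "T \<inter> S = {}" "card S \<le> card T + 1" "\<forall>x\<in>T. ?q x = 0"
      using Rolle_finite[OF \<open>finite S\<close> der zS] by blast
    have "(0::real poly) = 0 \<and> (\<forall>l\<in>L'. l * c' l = 0)"
    proof (rule Suc.hyps(1)[of 0 L' 0 "T \<union> D" "\<lambda>l. l * c' l" "{}"])
      have "card (T \<union> D) = card T + card D"
        using T Suc.prems DS by (intro card_Un_disjoint) auto
      then show "0 + card L' \<le> card (T \<union> D) + card {}" using Suc.prems 0 T fL' by auto
      show "\<forall>x\<in>T \<union> D. exp_poly 0 (\<lambda>l. l * c' l) L' x = 0"
        using T Suc.prems by (auto simp: q)
    qed (use Suc.hyps(2) 0 fL' T DS in auto)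
    then have c': "\<forall>l\<in>L'. c' l = 0" using fL' by auto
    have "c l0 = 0" using zS[OF s0] c' by (simp add: exp_poly_def)
    moreover have "c l = 0" if "l \<in> L" "l \<noteq> l0" for l
      using c' that by (auto simp: L'_def c'_def)
    ultimately show ?thesis using p by auto
  qed
qed

section \<open>Sign patterns of exponential polynomials\<close>

lemma interval_constant_sign:
  fixes f :: "real \<Rightarrow> real"
  assumes "is_interval A" "continuous_on A f" "\<And>x. x \<in> A \<Longrightarrow> f x \<noteq> 0"
  shows "(\<forall>x\<in>A. f x > 0) \<or> (\<forall>x\<in>A. f x < 0)"
proof (rule ccontr)
  assume "\<not> ?thesis"
  then obtain x y where xy: "x \<in> A" "y \<in> A" "f x \<le> 0" "0 \<le> f y" by force
  have "connected (f ` A)" using assms connected_continuous_image is_interval_connected_1 by blast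
  then have "0 \<in> f ` A" using xy unfolding connected_iff_interval by blast
  then show False using assms(3) by force
qed

text \<open>\<open>Z\<close> collects the zeros at which the sign switches, so the product over
  \<open>Z\<close> undoes the switches. The zeros are treated from left to right: the largest zero
  \<open>b\<close> joins \<open>Z\<close> exactly when the signs chosen on its two sides
  differ.\<close>

lemma sign_factorization:
  fixes f :: "real \<Rightarrow> real"
  assumes "finite S" "is_interval A" "continuous_on A f" "{x \<in> A. f x = 0} = S"
  shows "\<exists>Z\<subseteq>S. \<exists>\<sigma>\<in>{1, -1}. \<forall>x\<in>A. 0 \<le> \<sigma> * f x * (\<Prod>z\<in>Z. x - z)"
  using assms
proof (induction S arbitrary: A rule: finite_linorder_max_induct)
  case empty
  have "(\<forall>x\<in>A. f x > 0) \<or> (\<forall>x\<in>A. f x < 0)"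
    using empty.prems by (intro interval_constant_sign) auto
  then show ?case by (auto intro: less_imp_le)
next
  case (insert b S)
  define A' where "A' = A \<inter> {..<b}"
  have "\<exists>Z\<subseteq>S. \<exists>\<sigma>\<in>{1, -1}. \<forall>x\<in>A'. 0 \<le> \<sigma> * f x * (\<Prod>z\<in>Z. x - z)"
  proof (rule insert.IH)
    show "is_interval A'" unfolding A'_def using insert.prems by (auto intro: is_interval_Int)
    show "continuous_on A' f" using insert.prems(2) continuous_on_subset A'_def by blast
    have "{x \<in> A'. f x = 0} = insert b S \<inter> {..<b}" using insert.prems(3) A'_def by blast
    also have "\<dots> = S" using insert.hyps by auto
    finally show "{x \<in> A'. f x = 0} = S" .
  qed
  then obtain Z \<sigma> where Z: "Z \<subseteq> S" "\<sigma> \<in> {1, -1}" "\<And>x. x \<in> A' \<Longrightarrow> 0 \<le> \<sigma> * f x * (\<Prod>z\<in>Z. x - z)"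
    by blast
  define B where "B = A \<inter> {b<..}"
  have iB: "is_interval B" unfolding B_def using insert.prems by (auto intro: is_interval_Int)
  have cB: "continuous_on B f" using insert.prems(2) continuous_on_subset B_def by blast
  have nB: "f x \<noteq> 0" if "x \<in> B" for x
    using that insert.prems(3) insert.hyps unfolding B_def by fastforce
  have "(\<forall>x\<in>B. f x > 0) \<or> (\<forall>x\<in>B. f x < 0)"
    using iB cB nB by (rule interval_constant_sign)
  then obtain \<tau> :: real where tau: "\<tau> \<in> {1, -1}" "\<And>x. x \<in> B \<Longrightarrow> 0 \<le> \<tau> * f x"
    by (metis insertCI less_eq_real_def mult_1 mult_minus1 neg_0_less_iff_less)
  have fZ: "finite Z" using Z insert.hyps finite_subset by blast
  have bZ: "b \<notin> Z" using Z insert.hyps by auto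
  have posB: "0 \<le> (\<Prod>z\<in>Z. x - z)" if "x \<in> B" for x
    using that Z insert.hyps by (intro prod_nonneg) (force simp: B_def)
  have split: "x \<in> A' \<or> x = b \<or> x \<in> B" if "x \<in> A" for x using that by (auto simp: A'_def B_def)
  have fb: "f b = 0" using insert.prems(3) by blast
  show ?case
  proof (cases "\<sigma> = \<tau>")
    case True
    have "0 \<le> \<sigma> * f x * (\<Prod>z\<in>Z. x - z)" if "x \<in> A" for x
      using split[OF that] Z(3)[of x] fb mult_nonneg_nonneg[OF tau(2)[of x] posB[of x]] True by auto
    then show ?thesis using Z by blast
  next
    case False
    then have tau': "\<tau> = - \<sigma>" using tau Z by auto
    have "0 \<le> \<tau> * f x * (\<Prod>z\<in>insert b Z. x - z)" if "x \<in> A" for x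
    proof -
      \<comment> \<open>As \<open>\<tau> = - \<sigma>\<close>, the factor \<open>x - b\<close> can
        be read as \<open>b - x\<close> to the left of \<open>b\<close>, where the sign
        \<open>\<sigma>\<close> is the right one, and as it stands to the right.\<close>
      have e: "\<tau> * f x * (\<Prod>z\<in>insert b Z. x - z) = (\<sigma> * f x * (\<Prod>z\<in>Z. x - z)) * (b - x)"
         "\<tau> * f x * (\<Prod>z\<in>insert b Z. x - z) = (\<tau> * f x) * (\<Prod>z\<in>Z. x - z) * (x - b)"
        using fZ bZ tau' by (auto simp: algebra_simps)
      from split[OF that] show ?thesis
      proof (elim disjE)
        assume "x \<in> A'" then show ?thesis unfolding e(1) using Z(3)[of x] by (intro mult_nonneg_nonneg[of _ "b - x"]) (auto simp: A'_def)
      next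
        assume "x \<in> B" then show ?thesis unfolding e(2) using tau(2)[of x] posB[of x] by (intro mult_nonneg_nonneg[of _ "x - b"] mult_nonneg_nonneg[of "_ * f x"]) (auto simp: B_def)
      qed (simp add: fb)
    qed
    then show ?thesis using Z(1) tau(1) by (intro exI[of _ "insert b Z"]) blast
  qed
qed

text \<open>Gaussian elimination, one pivot \<open>j\<close> per equation \<open>y\<close>. Unknowns
  and equations are indexed by arbitrary finite sets, which allows unknowns of two kinds, tagged by
  \<open>Inl\<close>/\<open>Inr\<close> or \<open>None\<close>/\<open>Some\<close>.\<close>

lemma homogeneous_system_nontrivial:
  fixes a :: "'i \<Rightarrow> 'y \<Rightarrow> 'a::field"
  assumes "finite Y" "finite I" "card Y < card I"
  shows "\<exists>c. (\<exists>i\<in>I. c i \<noteq> 0) \<and> (\<forall>y\<in>Y. (\<Sum>i\<in>I. c i * a i y) = 0)"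
  using assms
proof (induction Y arbitrary: I a rule: finite_induct)
  case empty
  then have "I \<noteq> {}" by auto
  then show ?case by (intro exI[of _ "\<lambda>_. 1"]) auto
next
  case (insert y Y)
  show ?case
  proof (cases "\<forall>i\<in>I. a i y = 0")
    case True
    obtain c where "\<exists>i\<in>I. c i \<noteq> 0" "\<forall>y\<in>Y. (\<Sum>i\<in>I. c i * a i y) = 0"
      using insert.IH[of I a] insert.prems insert.hyps by auto
    with True show ?thesis by (intro exI[of _ c]) auto
  next
    case False
    then obtain j where j: "j \<in> I" "a j y \<noteq> 0" by blast
    let ?a = "\<lambda>i x. a i x - a i y / a j y * a j x"
    have "card Y < card (I - {j})" using insert.prems insert.hyps j by simp
    then obtain c where c: "\<exists>i\<in>I-{j}. c i \<noteq> 0" "\<forall>x\<in>Y. (\<Sum>i\<in>I-{j}. c i * ?a i x) = 0"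
      using insert.IH[of "I - {j}" ?a] insert.prems by blast
    define s where "s = - (\<Sum>i\<in>I-{j}. c i * a i y / a j y)"
    have "(\<Sum>i\<in>I. (c(j := s)) i * a i x) = (\<Sum>i\<in>I-{j}. c i * ?a i x)" for x
    proof -
      have "(\<Sum>i\<in>I. (c(j := s)) i * a i x) = s * a j x + (\<Sum>i\<in>I-{j}. c i * a i x)"
        using insert.prems j by (subst sum.remove[of I j]) (auto intro!: sum.cong)
      then show ?thesis
        by (simp add: s_def right_diff_distrib sum_subtractf sum_distrib_right mult.assoc)
    qed
    moreover have "(\<Sum>i\<in>I-{j}. c i * ?a i y) = 0" using j by simp
    ultimately show ?thesis using c j by (intro exI[of _ "c(j := s)"]) auto
  qed
qed

lemma poly_eq_sum_lessThan:
  fixes p :: "'a::{comm_semiring_0,semiring_1} poly"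
  assumes "\<forall>i\<ge>n. coeff p i = 0"
  shows "poly p x = (\<Sum>i<n. coeff p i * x ^ i)"
proof -
  have "poly p x = (\<Sum>i\<le>degree p. coeff p i * x ^ i)" by (rule poly_altdef)
  also have "\<dots> = (\<Sum>i<n. coeff p i * x ^ i)"
    using assms by (intro sum.mono_neutral_cong) (auto simp: coeff_eq_0 not_le not_less)
  finally show ?thesis .
qed

lemma exp_poly_interpolation:
  assumes "finite L" "0 \<notin> L" "finite S" "card S < d + card L"
  shows "\<exists>p c. (\<forall>i\<ge>d. coeff p i = 0) \<and> (\<forall>x\<in>S. exp_poly p c L x = 0) \<and>
    (p \<noteq> 0 \<or> (\<exists>l\<in>L. c l \<noteq> 0))"
proof -
  let ?I = "{..<d} <+> L"
  let ?a = "\<lambda>i (x::real). case i of Inl k \<Rightarrow> x ^ k | Inr l \<Rightarrow> exp (l * x)"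
  obtain c where c: "\<exists>i\<in>?I. c i \<noteq> 0" "\<forall>x\<in>S. (\<Sum>i\<in>?I. c i * ?a i x) = 0"
    using homogeneous_system_nontrivial[of S ?I ?a] assms by (auto simp: card_Plus)
  define p where "p = (\<Sum>k<d. monom (c (Inl k)) k)"
  have cp: "coeff p i = (if i < d then c (Inl i) else 0)" for i
    by (auto simp: p_def coeff_sum)
  have "exp_poly p (\<lambda>l. c (Inr l)) L x = (\<Sum>i\<in>?I. c i * ?a i x)" for x
    using assms by (simp add: exp_poly_def p_def poly_sum poly_monom sum.Plus)
  moreover have "p \<noteq> 0 \<or> (\<exists>l\<in>L. c (Inr l) \<noteq> 0)"
    using c(1) cp by (metis PlusE coeff_0 lessThan_iff)
  ultimately show ?thesis using c cp by (intro exI[of _ p] exI[of _ "\<lambda>l. c (Inr l)"]) auto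
qed

lemma exp_poly_finite_zeros:
  assumes "finite L" "0 \<notin> L" "\<forall>i\<ge>d. coeff p i = 0" "p \<noteq> 0 \<or> (\<exists>l\<in>L. c l \<noteq> 0)"
  shows "finite {x. exp_poly p c L x = 0}" "card {x. exp_poly p c L x = 0} < d + card L"
proof -
  have *: "card S < d + card L" if "finite S" "S \<subseteq> {x. exp_poly p c L x = 0}" for S
    using exp_poly_zeros[OF assms(1-3) that(1), of c "{}"] assms(4) that(2) by fastforce
  show "finite {x. exp_poly p c L x = 0}"
    using * by (metis infinite_arbitrarily_large less_irrefl)
  with * show "card {x. exp_poly p c L x = 0} < d + card L" by blast
qed

text \<open>\<open>S\<close> already has the largest possible number of zeros. So there are no
  others, and the sign changes at each of them: a zero without sign change would be a double zero,
  which makes one zero too many.\<close>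

lemma exp_poly_sign:
  assumes L: "finite L" "0 \<notin> L" "\<forall>i\<ge>d. coeff p i = 0" "p \<noteq> 0 \<or> (\<exists>l\<in>L. c l \<noteq> 0)"
    and S: "finite S" "\<forall>x\<in>S. exp_poly p c L x = 0" "card S + 1 = d + card L"
  shows "\<exists>\<sigma>\<in>{1, -1}. \<forall>x. x \<notin> S \<longrightarrow> 0 < \<sigma> * exp_poly p c L x * (\<Prod>s\<in>S. x - s)"
proof -
  let ?f = "exp_poly p c L"
  have eq: "{x. ?f x = 0} = S"
    using card_seteq[of "{x. ?f x = 0}" S] exp_poly_finite_zeros[OF L] S by force
  obtain Z \<sigma> where Z: "Z \<subseteq> S" "\<sigma> \<in> {1, -1}" "\<And>x. 0 \<le> \<sigma> * ?f x * (\<Prod>z\<in>Z. x - z)"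
    using sign_factorization[OF S(1) is_interval_univ continuous_on_exp_poly, of p c L] eq
    by (simp only: UNIV_I simp_thms ball_UNIV) blast
  have "Z = S"
  proof (rule ccontr)
    assume "Z \<noteq> S"
    then obtain s where s: "s \<in> S" "s \<notin> Z" using Z by blast
    have fZ: "finite Z" using Z S finite_subset by blast
    \<comment> \<open>The product omits \<open>s\<close>. Hence \<open>?F\<close> has its minimum 0
      at \<open>s\<close>, and its derivative there is \<open>?f'\<close> times a nonzero
      number.\<close>
    let ?P = "\<Prod>z\<in>Z. [:-z, 1:] :: real poly"
    have P: "poly ?P x = (\<Prod>z\<in>Z. x - z)" for x by (simp add: poly_prod)
    let ?F = "\<lambda>x. \<sigma> * ?f x * poly ?P x"
    let ?f' = "exp_poly (pderiv p) (\<lambda>l. l * c l) L s"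
    have fs: "?f s = 0" using s S by blast
    have "(?F has_real_derivative \<sigma> * ?f' * poly ?P s) (at s)"
      using fs by (auto intro!: derivative_eq_intros exp_poly_DERIV)
    moreover have "?F s \<le> ?F x" for x using Z(3) fs P by simp
    ultimately have "\<sigma> * ?f' * poly ?P s = 0"
      by (intro DERIV_local_min[of ?F _ s 1]) auto
    moreover have "poly ?P s \<noteq> 0" using s fZ by (auto simp: poly_prod)
    ultimately have "?f' = 0" using Z(2) by auto
    then have "p = 0 \<and> (\<forall>l\<in>L. c l = 0)"
      using s(1) S(3) by (intro exp_poly_zeros[OF L(1-3) S(1,2), of "{s}"]) simp_all
    then show False using L by blast
  qed
  then have "0 < \<sigma> * ?f x * (\<Prod>s\<in>S. x - s)" if "x \<notin> S" for x
    using that Z(2) Z(3)[of x] eq S(1) by (auto simp: less_le)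
  then show ?thesis using Z(2) by blast
qed

section \<open>Trading exponentials for powers\<close>

text \<open>Negative frequencies die out at infinity, so the coefficient of the top power alone
  decides the sign there.\<close>

lemma exp_poly_leading:
  assumes "finite L" "\<forall>l\<in>L. l < 0" "\<forall>i>d. coeff p i = 0"
  shows "((\<lambda>x. exp_poly p c L x / x ^ d) \<longlongrightarrow> coeff p d) at_top"
proof -
  have pow: "((\<lambda>x::real. x ^ i / x ^ d) \<longlongrightarrow> (if i = d then 1 else 0)) at_top" if "i \<le> d" for i
  proof -
    have "((\<lambda>x::real. inverse x ^ (d - i)) \<longlongrightarrow> 0 ^ (d - i)) at_top"
      by (intro tendsto_power tendsto_inverse_0_at_top filterlim_ident)
    moreover have "eventually (\<lambda>x::real. inverse x ^ (d - i) = x ^ i / x ^ d) at_top"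
      using eventually_gt_at_top[of 0]
      by eventually_elim (use that in \<open>simp add: power_diff field_simps\<close>)
    ultimately have "((\<lambda>x::real. x ^ i / x ^ d) \<longlongrightarrow> 0 ^ (d - i)) at_top"
      by (rule Lim_transform_eventually)
    then show ?thesis using that by (auto simp: power_0_left)
  qed
  have ex: "((\<lambda>x::real. exp (l * x) / x ^ d) \<longlongrightarrow> 0) at_top" if "l \<in> L" for l
  proof -
    have "l < 0" using that assms by blast
    then have "((\<lambda>x. exp (l * x)) \<longlongrightarrow> 0) at_top"
      by (intro filterlim_compose[OF exp_at_bot] filterlim_tendsto_neg_mult_at_bot[OF tendsto_const])
        (auto intro: filterlim_ident)
    moreover have "((\<lambda>x::real. inverse x ^ d) \<longlongrightarrow> 0 ^ d) at_top"
      by (intro tendsto_power tendsto_inverse_0_at_top filterlim_ident)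
    ultimately have "((\<lambda>x. exp (l * x) * inverse x ^ d) \<longlongrightarrow> 0 * 0 ^ d) at_top"
      by (rule tendsto_mult)
    then show ?thesis by (simp add: field_simps)
  qed
  have "exp_poly p c L x / x ^ d =
      (\<Sum>i\<le>d. coeff p i * (x ^ i / x ^ d)) + (\<Sum>l\<in>L. c l * (exp (l * x) / x ^ d))" for x
  proof -
    have "poly p x = (\<Sum>i\<le>d. coeff p i * x ^ i)"
      using poly_eq_sum_lessThan[of "Suc d" p x] assms(3) by (simp add: lessThan_Suc_atMost Suc_le_eq)
    then show ?thesis by (simp add: exp_poly_def add_divide_distrib sum_divide_distrib)
  qed
  moreover have "((\<lambda>x. (\<Sum>i\<le>d. coeff p i * (x ^ i / x ^ d)) + (\<Sum>l\<in>L. c l * (exp (l * x) / x ^ d)))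
      \<longlongrightarrow> (\<Sum>i\<le>d. coeff p i * (if i = d then 1 else 0)) + (\<Sum>l\<in>L. c l * 0)) at_top"
    by (intro tendsto_add tendsto_sum tendsto_mult tendsto_const pow ex) auto
  ultimately show ?thesis by (simp add: if_distrib cong: if_cong)
qed

lemma exp_poly_eventually_neg:
  assumes "finite L" "\<forall>l\<in>L. l < 0" "\<forall>i>d. coeff p i = 0" "coeff p d < 0"
  shows "eventually (\<lambda>x. exp_poly p c L x < 0) at_top"
  using order_tendstoD(2)[OF exp_poly_leading[OF assms(1-3), of c] assms(4)] eventually_gt_at_top[of 0]
  by eventually_elim (auto simp: divide_less_0_iff)

text \<open>The difference of the two functions lies in a space of dimension \<open>card X + 2\<close> and vanishes
  on \<open>insert M X\<close>, so its sign pattern is determined by its behaviour at infinity.\<close>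
lemma exp_poly_exchange:
  assumes L: "finite L" "\<forall>l\<in>L. l < 0" "\<forall>i\<ge>d. coeff p i = 0" "l \<in> L"
    and X: "finite X" "card X + 1 = d + card L" "\<forall>x\<in>X. x < M \<and> exp_poly p c L x = 0"
    and M: "0 < exp_poly p c L M"
  shows "\<exists>p' c'. (\<forall>i\<ge>Suc d. coeff p' i = 0) \<and> (\<forall>x\<in>X. exp_poly p' c' (L - {l}) x = 0) \<and>
    exp_poly p' c' (L - {l}) M = exp_poly p c L M \<and>
    (\<forall>x\<le>M. \<bar>exp_poly p' c' (L - {l}) x\<bar> \<le> \<bar>exp_poly p c L x\<bar>)"
proof -
  let ?L = "L - {l}" and ?g = "exp_poly p c L"
  have L': "finite ?L" "0 \<notin> ?L" "\<forall>l\<in>?L. l < 0" "card L = Suc (card ?L)"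
    using L card.remove[OF L(1,4)] by blast+
  have L0: "0 \<notin> L" using L by auto
  have cX: "card X + 1 = Suc d + card ?L" using X(2) L'(4) by linarith
  \<comment> \<open>Dropping the frequency \<open>l\<close> and admitting the power \<open>d\<close>
    keeps the dimension at \<open>card X + 1\<close>. The zeros in \<open>X\<close> therefore leave
    one free scale, which \<open>t\<close> fixes by matching the value at \<open>M\<close>.\<close>
  obtain p0 c0 where p0: "\<forall>i\<ge>Suc d. coeff p0 i = 0" "\<forall>x\<in>X. exp_poly p0 c0 ?L x = 0"
    "p0 \<noteq> 0 \<or> (\<exists>l\<in>?L. c0 l \<noteq> 0)"
    using exp_poly_interpolation[OF L'(1,2) X(1), of "Suc d"] cX by (metis less_add_one)
  have MX: "M \<notin> X" using X by auto
  have "exp_poly p0 c0 ?L M \<noteq> 0"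
    using exp_poly_zeros[OF L'(1,2) p0(1), of "insert M X" c0 "{}"] p0 X(1) cX MX by auto
  define t where "t = ?g M / exp_poly p0 c0 ?L M"
  have t: "t \<noteq> 0" using M \<open>exp_poly p0 c0 ?L M \<noteq> 0\<close> by (auto simp: t_def)
  define p' where "p' = Polynomial.smult t p0"
  define c' where "c' = (\<lambda>l. t * c0 l)"
  let ?h = "exp_poly p' c' ?L"
  have h: "?h x = t * exp_poly p0 c0 ?L x" for x
    by (simp add: exp_poly_def p'_def c'_def sum_distrib_left distrib_left mult.assoc)
  have hM: "?h M = ?g M" using h \<open>exp_poly p0 c0 ?L M \<noteq> 0\<close> by (simp add: t_def)
  have hX: "\<forall>x\<in>X. ?h x = 0" using p0 h by simp
  have p': "\<forall>i\<ge>Suc d. coeff p' i = 0" "p' \<noteq> 0 \<or> (\<exists>l\<in>?L. c' l \<noteq> 0)"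
    using p0 t by (auto simp: p'_def c'_def)
  obtain \<sigma> where s: "\<sigma> \<in> {1, -1}" "\<And>x. x \<notin> X \<Longrightarrow> 0 < \<sigma> * ?h x * (\<Prod>s\<in>X. x - s)"
    using exp_poly_sign[OF L'(1,2) p' X(1) hX cX] by blast
  have prodpos: "0 < (\<Prod>s\<in>X. x - s)" if "M \<le> x" for x
    using that X by (intro prod_pos) fastforce
  have s1: "\<sigma> = 1"
    using s(1) s(2)[OF MX] prodpos[of M] M hM by (auto simp: zero_less_mult_iff)
  \<comment> \<open>Without the coefficient of index \<open>d\<close>, \<open>?h\<close> would lie
    in a space of dimension \<open>card X\<close> and have \<open>card X\<close> zeros.\<close>
  have ad: "coeff p' d \<noteq> 0"
  proof
    assume "coeff p' d = 0"
    then have "\<forall>i\<ge>d. coeff p' i = 0" using p'(1) by (metis Suc_leI le_neq_implies_less)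
    then show False using exp_poly_zeros[OF L'(1,2) _ X(1) hX, of d "{}"] p'(2) cX by auto
  qed
  have "\<not> coeff p' d < 0"
  proof
    assume "coeff p' d < 0"
    then have "eventually (\<lambda>x. ?h x < 0) at_top"
      using p'(1) L' by (intro exp_poly_eventually_neg[of _ d]) auto
    then have "eventually (\<lambda>x. ?h x < 0 \<and> M < x) at_top"
      using eventually_gt_at_top[of M] by eventually_elim auto
    then obtain x where x: "?h x < 0" "M < x"
      using eventually_happens'[OF trivial_limit_at_top_linorder] by blast
    have "x \<notin> X" using x(2) X(3) by (meson less_asym)
    then show False using s(2)[of x] s1 x prodpos[of x] by (auto simp: zero_less_mult_iff)
  qed
  then have a: "0 < coeff p' d" using ad by linarith
  define q where "q = p - p'"
  define e where "e = (\<lambda>k. c k - (if k = l then 0 else c' k))"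
  let ?D = "exp_poly q e L"
  have D: "?D x = ?g x - ?h x" for x
  proof -
    have "(\<Sum>k\<in>L. (if k = l then 0 else c' k) * exp (k * x)) = (\<Sum>k\<in>?L. c' k * exp (k * x))"
      using L by (intro sum.mono_neutral_cong_right) auto
    then show ?thesis
      by (simp add: exp_poly_def q_def e_def left_diff_distrib sum_subtractf)
  qed
  \<comment> \<open>\<open>p\<close> has no term of degree \<open>d\<close>, so the top coefficient
    of the difference is minus that of \<open>?h\<close>. This makes the difference negative at
    infinity.\<close>
  have q: "\<forall>i\<ge>Suc d. coeff q i = 0" "coeff q d < 0" using p'(1) L(3) a by (auto simp: q_def)
  have q0: "q \<noteq> 0 \<or> (\<exists>l\<in>L. e l \<noteq> 0)" using q by auto
  have DX: "\<forall>x\<in>insert M X. ?D x = 0" using D hM hX X by simp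
  have fMX: "finite (insert M X)" "card (insert M X) + 1 = Suc d + card L" using X MX by simp_all
  obtain \<tau> where ta: "\<tau> \<in> {1, -1}" "\<And>x. x \<notin> insert M X \<Longrightarrow> 0 < \<tau> * ?D x * (\<Prod>s\<in>insert M X. x - s)"
    using exp_poly_sign[OF L(1) L0 q(1) q0 fMX(1) DX fMX(2)] by blast
  have "eventually (\<lambda>x. ?D x < 0) at_top"
    using q L by (intro exp_poly_eventually_neg[of _ d]) auto
  then have "eventually (\<lambda>x. ?D x < 0 \<and> M < x) at_top"
    using eventually_gt_at_top[of M] by eventually_elim auto
  then obtain x0 where x0: "?D x0 < 0" "M < x0"
      using eventually_happens'[OF trivial_limit_at_top_linorder] by blast
  have "x0 \<notin> insert M X" using x0(2) X(3) by (metis insert_iff less_asym less_irrefl)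
  then have "0 < \<tau> * ?D x0 * (\<Prod>s\<in>insert M X. x0 - s)" by (rule ta(2))
  moreover have "0 < (\<Prod>s\<in>insert M X. x0 - s)"
    using prodpos[of x0] x0(2) X(1) MX by simp
  ultimately have "0 < \<tau> * ?D x0" by (simp add: zero_less_mult_iff)
  then have t1: "\<tau> = -1" using ta(1) x0(1) by auto
  \<comment> \<open>Below \<open>M\<close> and off \<open>X\<close>, both \<open>?h\<close> and
    \<open>?g - ?h\<close> have the sign of the product over \<open>X\<close>. So they cannot
    cancel, and \<open>\<bar>?g\<bar> = \<bar>?h\<bar> + \<bar>?g - ?h\<bar>\<close>.\<close>
  have "\<bar>?h x\<bar> \<le> \<bar>?g x\<bar>" if "x \<le> M" for x
  proof (cases "x \<in> insert M X")
    case True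
    then show ?thesis using hM hX by (cases "x = M") simp_all
  next
    case False
    let ?P = "\<Prod>s\<in>X. x - s"
    have "-1 * ?D x * ((x - M) * ?P) = (M - x) * (?D x * ?P)" by (simp add: algebra_simps)
    then have "0 < (M - x) * (?D x * ?P)"
      using ta(2)[OF False] unfolding t1 prod.insert[OF X(1) MX] by linarith
    then have "0 < ?D x * ?P" using that False by (simp add: zero_less_mult_iff)
    then have "?h x * ?P < ?g x * ?P" by (simp add: D left_diff_distrib)
    moreover have "0 < ?h x * ?P" using s(2)[of x] s1 False by simp
    ultimately have "\<bar>?h x * ?P\<bar> \<le> \<bar>?g x * ?P\<bar>" by linarith
    moreover have "0 < \<bar>?P\<bar>" using \<open>0 < ?h x * ?P\<close> by auto
    ultimately show ?thesis unfolding abs_mult by (rule mult_right_le_imp_le)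
  qed
  then show ?thesis using p'(1) hX hM by blast
qed

text \<open>An exchange preserves the zeros \<open>X\<close>, the value at \<open>M\<close> and the
  dimension \<open>d + card L\<close>, so it can be repeated until no frequency is left; the
  dimension then bounds the degree.\<close>

lemma exp_poly_polynomial_minorant:
  assumes "finite L" "\<forall>l\<in>L. l < 0" "\<forall>i\<ge>d. coeff p i = 0"
    and "finite X" "card X + 1 = d + card L" "\<forall>x\<in>X. x < M \<and> exp_poly p c L x = 0"
    and "0 < exp_poly p c L M"
  shows "\<exists>q. (\<forall>i\<ge>d + card L. coeff q i = 0) \<and> poly q M = exp_poly p c L M \<and>
    (\<forall>x\<le>M. \<bar>poly q x\<bar> \<le> \<bar>exp_poly p c L x\<bar>)"
  using assms
proof (induction "card L" arbitrary: L d p c)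
  case 0
  then show ?case by (intro exI[of _ p]) (auto simp: exp_poly_def)
next
  case (Suc k)
  then obtain l where l: "l \<in> L" by (metis card.empty ex_in_conv nat.distinct(1))
  have k: "k = card (L - {l})" "card L = Suc (card (L - {l}))"
    using Suc(2) card.remove[OF Suc.prems(1) l] by linarith+
  obtain p' c' where *: "\<forall>i\<ge>Suc d. coeff p' i = 0" "\<forall>x\<in>X. exp_poly p' c' (L - {l}) x = 0"
    "exp_poly p' c' (L - {l}) M = exp_poly p c L M"
    "\<forall>x\<le>M. \<bar>exp_poly p' c' (L - {l}) x\<bar> \<le> \<bar>exp_poly p c L x\<bar>"
    using exp_poly_exchange[OF Suc.prems(1-3) l Suc.prems(4-7)] by blast
  obtain q where q: "\<forall>i\<ge>Suc d + card (L - {l}). coeff q i = 0" "poly q M = exp_poly p' c' (L - {l}) M"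
    "\<forall>x\<le>M. \<bar>poly q x\<bar> \<le> \<bar>exp_poly p' c' (L - {l}) x\<bar>"
    using Suc.hyps(1)[OF k(1) _ _ *(1) Suc.prems(4), of c'] Suc.prems * k by auto
  show ?case
  proof (intro exI[of _ q] conjI)
    show "\<forall>i\<ge>d + card L. coeff q i = 0" using q(1) k by simp
    show "\<forall>x\<le>M. \<bar>poly q x\<bar> \<le> \<bar>exp_poly p c L x\<bar>" using q(3) *(4) by (meson order_trans)
  qed (use q * in simp)
qed

section \<open>Extrapolation with respect to a compactly supported measure\<close>

text \<open>Each point outside the support has a basic open neighbourhood of measure zero, and a
  countable basis contains only countably many of these.\<close>

lemma AE_measure_support:
  fixes \<mu> :: "'a::second_countable_topology measure"
  assumes "sets \<mu> = sets borel"
  shows "AE x in \<mu>. x \<in> measure_support \<mu>"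
proof -
  obtain B :: "'a set set" where B: "countable B" "topological_basis B"
    using ex_countable_basis by auto
  define B0 where "B0 = {b \<in> B. emeasure \<mu> b = 0}"
  have "(\<Union>b\<in>B0. b) \<in> null_sets \<mu>"
  proof (rule null_sets_UN')
    show "countable B0" using B(1) by (simp add: B0_def)
    show "b \<in> null_sets \<mu>" if "b \<in> B0" for b
      using that B(2) assms by (auto simp: B0_def null_sets_def topological_basis_open)
  qed
  moreover have "{x \<in> space \<mu>. x \<notin> measure_support \<mu>} \<subseteq> (\<Union>b\<in>B0. b)"
  proof
    fix x assume "x \<in> {x \<in> space \<mu>. x \<notin> measure_support \<mu>}"
    then obtain U where U: "open U" "x \<in> U" "emeasure \<mu> U = 0"
      by (auto simp: measure_support_def zero_less_iff_neq_zero)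
    then obtain b where b: "b \<in> B" "x \<in> b" "b \<subseteq> U" using B(2) by (meson topological_basisE)
    have "emeasure \<mu> b = 0"
      using emeasure_mono[OF b(3), of \<mu>] U assms by simp
    then show "x \<in> (\<Union>b\<in>B0. b)" using b by (auto simp: B0_def)
  qed
  ultimately show ?thesis by (rule AE_I')
qed

text \<open>Finiteness and compact support make every continuous function integrable, which reduces
  integrability questions below to continuity.\<close>

locale compact_support_measure = finite_measure \<mu> for \<mu> :: "real measure" +
  assumes sets_eq_borel: "sets \<mu> = sets borel"
    and compact_support: "compact (measure_support \<mu>)"
begin

lemma AE_support: "(\<And>x. x \<in> measure_support \<mu> \<Longrightarrow> P x) \<Longrightarrow> AE x in \<mu>. P x"
  using AE_measure_support[OF sets_eq_borel] by (rule eventually_mono)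

lemma measurable_continuous: "continuous_on UNIV h \<Longrightarrow> h \<in> borel_measurable \<mu>"
  for h :: "real \<Rightarrow> real"
  by (subst measurable_cong_sets[OF sets_eq_borel refl]) (rule borel_measurable_continuous_onI)

lemma integrable_continuous: "continuous_on UNIV h \<Longrightarrow> integrable \<mu> h" for h :: "real \<Rightarrow> real"
proof -
  assume h: "continuous_on UNIV h"
  have "bounded (h ` measure_support \<mu>)"
    by (intro compact_imp_bounded compact_continuous_image continuous_on_subset[OF h] compact_support) simp
  then obtain B where "\<And>x. x \<in> measure_support \<mu> \<Longrightarrow> norm (h x) \<le> B"
    by (auto simp: bounded_iff)
  then show ?thesis
    using measurable_continuous[OF h] by (intro integrable_const_bound[of h B] AE_support) auto
qed

lemma integral_mono_support:
  fixes f g :: "real \<Rightarrow> real"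
  assumes "continuous_on UNIV f" "continuous_on UNIV g" "\<And>x. x \<in> measure_support \<mu> \<Longrightarrow> f x \<le> g x"
  shows "(LINT x|\<mu>. f x) \<le> (LINT x|\<mu>. g x)"
  using assms by (intro integral_mono_AE integrable_continuous AE_support)

lemma integral_nonneg_support:
  fixes f :: "real \<Rightarrow> real"
  assumes "\<And>x. x \<in> measure_support \<mu> \<Longrightarrow> 0 \<le> f x"
  shows "0 \<le> (LINT x|\<mu>. f x)"
  using assms by (intro integral_nonneg_AE AE_support)

text \<open>The set where \<open>f\<close> does not vanish is open and null, so it misses the
  support. This turns a vanishing integral into zeros at the finitely many points of
  \<open>T\<close>, which can then be counted.\<close>

lemma integral_zero_support:
  fixes f :: "real \<Rightarrow> real"
  assumes f: "continuous_on UNIV f" "\<And>x. x \<in> measure_support \<mu> \<Longrightarrow> 0 \<le> f x"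
    and "(LINT x|\<mu>. f x) = 0" and x: "x \<in> measure_support \<mu>"
  shows "f x = 0"
proof (rule ccontr)
  assume "f x \<noteq> 0"
  let ?U = "{y. f y \<noteq> 0}"
  have "open ?U" using f(1) open_Collect_neq[OF f(1) continuous_on_const] by simp
  then have "0 < emeasure \<mu> ?U" using x \<open>f x \<noteq> 0\<close> by (auto simp: measure_support_def)
  moreover have "AE y in \<mu>. f y = 0"
    using assms integral_nonneg_eq_0_iff_AE[OF integrable_continuous[OF f(1)] AE_support] by blast
  then have "emeasure \<mu> ?U = 0"
    using AE_iff_measurable[of ?U \<mu> "\<lambda>y. f y = 0"] \<open>open ?U\<close> sets_eq_borel sets_eq_imp_space_eq[OF sets_eq_borel]
    by simp
  ultimately show False by simp
qed

lemma integral_exp_poly_mult: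
  assumes "continuous_on UNIV h"
  shows "(LINT a|\<mu>. exp_poly 0 c L a * h a) = (\<Sum>l\<in>L. c l * (LINT a|\<mu>. exp (l * a) * h a))"
proof -
  have "(LINT a|\<mu>. exp_poly 0 c L a * h a) = (LINT a|\<mu>. (\<Sum>l\<in>L. c l * (exp (l * a) * h a)))"
    by (simp add: exp_poly_def sum_distrib_right mult.assoc)
  also have "\<dots> = (\<Sum>l\<in>L. LINT a|\<mu>. c l * (exp (l * a) * h a))"
    using assms by (intro Bochner_Integration.integral_sum integrable_continuous continuous_intros)
  finally show ?thesis by simp
qed

section \<open>Reproducing elements and extrapolation\<close>

lemma weighted_Cauchy_Schwarz:
  fixes W k g :: "real \<Rightarrow> real"
  assumes W: "continuous_on UNIV W" "\<And>a. a \<in> measure_support \<mu> \<Longrightarrow> 0 \<le> W a"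
    and k: "continuous_on UNIV k" "continuous_on UNIV g" "0 < (LINT a|\<mu>. W a * (k a * k a))"
  shows "(LINT a|\<mu>. W a * (k a * g a))\<^sup>2 \<le> (LINT a|\<mu>. W a * (k a * k a)) * (LINT a|\<mu>. W a * (g a)\<^sup>2)"
proof -
  let ?kk = "LINT a|\<mu>. W a * (k a * k a)" and ?kg = "LINT a|\<mu>. W a * (k a * g a)"
  \<comment> \<open>The coefficient of the orthogonal projection of \<open>g\<close> onto
    \<open>k\<close>, at which the integral of \<open>W a * (g a - t * k a)\<^sup>2\<close> is
    smallest.\<close>
  define t where "t = ?kg / ?kk"
  have int: "integrable \<mu> (\<lambda>a. W a * (h a * h' a))" if "continuous_on UNIV h" "continuous_on UNIV h'" for h h'
    using that by (intro integrable_continuous continuous_intros W(1))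
  have "0 \<le> (LINT a|\<mu>. W a * (g a - t * k a)\<^sup>2)"
    using W(2) by (intro integral_nonneg_support) simp
  also have "\<dots> = (LINT a|\<mu>. (W a * (g a * g a) - 2 * t * (W a * (k a * g a))) + t\<^sup>2 * (W a * (k a * k a)))"
    by (intro Bochner_Integration.integral_cong refl) (simp add: power2_eq_square algebra_simps)
  also have "\<dots> = (LINT a|\<mu>. W a * (g a * g a)) - 2 * t * ?kg + t\<^sup>2 * ?kk"
    by (simp add: int k)
  also have "\<dots> = (LINT a|\<mu>. W a * (g a)\<^sup>2) - ?kg\<^sup>2 / ?kk"
    using k(3) by (simp add: t_def power2_eq_square field_simps)
  finally show ?thesis using k(3) by (simp add: field_simps)
qed

text \<open>The Riesz representer of evaluation at \<open>M\<close> in the span of the exponentials.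
  The inner product is definite because a nonzero combination of \<open>card L\<close> exponentials
  cannot vanish on all of \<open>T\<close>. The value of the representer at \<open>M\<close> is its
  squared norm, hence positive.\<close>

lemma exp_poly_reproducing:
  assumes W: "continuous_on UNIV W" "\<And>a. a \<in> measure_support \<mu> \<Longrightarrow> 0 \<le> W a"
    and T: "finite T" "T \<subseteq> measure_support \<mu>" "\<And>t. t \<in> T \<Longrightarrow> 0 < W t"
    and L: "finite L" "0 \<notin> L" "L \<noteq> {}" "card L \<le> card T"
  obtains c where "\<And>b. (LINT a|\<mu>. W a * (exp_poly 0 c L a * exp_poly 0 b L a)) = exp_poly 0 b L M"
    and "0 < exp_poly 0 c L M"
proof -
  define J where "J h = (LINT a|\<mu>. W a * h a)" for h
  have J_mult: "J (\<lambda>a. exp_poly 0 c L a * h a) = (\<Sum>l\<in>L. c l * J (\<lambda>a. exp (l * a) * h a))"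
    if "continuous_on UNIV h" for c h
    using integral_exp_poly_mult[of "\<lambda>a. W a * h a" c L] that W(1)
    by (simp add: J_def mult.left_commute continuous_on_mult)
  have definite: "\<forall>l\<in>L. c l = 0" if "J (\<lambda>a. exp_poly 0 c L a * exp_poly 0 c L a) = 0" for c
  proof -
    have "exp_poly 0 c L t = 0" if "t \<in> T" for t
    proof -
      have "W t * (exp_poly 0 c L t * exp_poly 0 c L t) = 0"
        using \<open>J _ = 0\<close> that T(2) W unfolding J_def
        by (intro integral_zero_support[of "\<lambda>a. W a * (exp_poly 0 c L a * exp_poly 0 c L a)"])
          (auto intro!: continuous_intros)
      then show ?thesis using T(3)[OF that] by simp
    qed
    then show ?thesis using exp_poly_zeros[OF L(1,2) _ T(1), of 0 0 c "{}"] L(4) by auto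
  qed
  \<comment> \<open>The right-hand side \<open>exp (m * M)\<close> gets an unknown of its own,
    \<open>None\<close>, which makes the system homogeneous with one unknown more than equations.
    Definiteness forces \<open>x None \<noteq> 0\<close>, and dividing by it gives the
    representer.\<close>
  define A where "A i m = (case i of None \<Rightarrow> - exp (m * M) | Some l \<Rightarrow> J (\<lambda>a. exp (l * a) * exp (m * a)))" for i m
  obtain x where x: "\<exists>i\<in>insert None (Some ` L). x i \<noteq> 0"
    "\<forall>m\<in>L. (\<Sum>i\<in>insert None (Some ` L). x i * A i m) = 0"
    using homogeneous_system_nontrivial[of L "insert None (Some ` L)" A] L(1)
    by (auto simp: card_image)
  have xs: "(\<Sum>l\<in>L. x (Some l) * J (\<lambda>a. exp (l * a) * exp (m * a))) = x None * exp (m * M)" if "m \<in> L" for m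
    using x(2) that L(1) by (auto simp: A_def sum.reindex)
  have x0: "x None \<noteq> 0"
  proof
    assume *: "x None = 0"
    let ?k = "exp_poly 0 (\<lambda>l. x (Some l)) L"
    have "J (\<lambda>a. ?k a * exp (m * a)) = 0" if "m \<in> L" for m
      using J_mult[of "\<lambda>a. exp (m * a)"] xs[OF that] * by (simp add: continuous_intros)
    then have "J (\<lambda>a. ?k a * ?k a) = 0"
      by (subst J_mult) (auto intro!: continuous_intros sum.neutral simp: mult.commute)
    then show False using definite x(1) * by auto
  qed
  define c where "c l = x (Some l) / x None" for l
  let ?k = "exp_poly 0 c L"
  have Jk: "J (\<lambda>a. ?k a * exp (m * a)) = exp (m * M)" if "m \<in> L" for m
    using J_mult[of "\<lambda>a. exp (m * a)" c] xs[OF that] x0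
    by (simp add: continuous_intros c_def sum_divide_distrib[symmetric])
  have rep: "J (\<lambda>a. ?k a * exp_poly 0 b L a) = exp_poly 0 b L M" for b
    using J_mult[of ?k b] Jk by (simp add: continuous_intros mult.commute exp_poly_def)
  have "0 \<le> J (\<lambda>a. ?k a * ?k a)"
    unfolding J_def by (intro integral_nonneg_support) (simp add: W)
  moreover have "J (\<lambda>a. ?k a * ?k a) \<noteq> 0"
  proof
    assume "J (\<lambda>a. ?k a * ?k a) = 0"
    then have c0: "\<forall>l\<in>L. c l = 0" by (rule definite)
    obtain m where "m \<in> L" using L(3) by blast
    then have "exp (m * M) = 0"
      using Jk J_mult[of "\<lambda>a. exp (m * a)" c] c0 by (simp add: continuous_intros)
    then show False by simp
  qed
  ultimately have "0 < ?k M" using rep[of c] by simp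
  with rep show thesis using that unfolding J_def by blast
qed

text \<open>A reproducing element with fewer sign changes would be orthogonal to a function
  vanishing at \<open>M\<close> and having exactly the same sign changes below \<open>M\<close>.\<close>
lemma exp_poly_reproducing_zeros:
  assumes W: "continuous_on UNIV W" "\<And>a. a \<in> measure_support \<mu> \<Longrightarrow> 0 \<le> W a"
    and T: "finite T" "T \<subseteq> measure_support \<mu>" "\<And>t. t \<in> T \<Longrightarrow> 0 < W t"
    and M: "measure_support \<mu> \<subseteq> {..<M}"
    and L: "finite L" "0 \<notin> L" "card L \<le> card T"
    and c: "\<And>b. (LINT a|\<mu>. W a * (exp_poly 0 c L a * exp_poly 0 b L a)) = exp_poly 0 b L M"
      "0 < exp_poly 0 c L M"
  shows "\<exists>Z. finite Z \<and> card Z + 1 = card L \<and> (\<forall>x\<in>Z. x < M \<and> exp_poly 0 c L x = 0)"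
proof -
  let ?k = "exp_poly 0 c L"
  have c0: "\<exists>l\<in>L. c l \<noteq> 0"
  proof (rule ccontr)
    assume "\<not> ?thesis"
    then have "?k M = 0" by (simp add: exp_poly_def)
    then show False using c(2) by simp
  qed
  define S where "S = {x \<in> {..<M}. ?k x = 0}"
  have S: "finite S" "card S < card L"
  proof -
    have z: "finite {x. ?k x = 0}" "card {x. ?k x = 0} < card L"
      using exp_poly_finite_zeros[OF L(1,2), of 0 0 c] c0 by simp_all
    then show "finite S" unfolding S_def by (auto elim: rev_finite_subset)
    have "card S \<le> card {x. ?k x = 0}" unfolding S_def by (intro card_mono z) auto
    then show "card S < card L" using z(2) by simp
  qed
  obtain Z \<sigma> where Z: "Z \<subseteq> S" "\<sigma> \<in> {1, -1}" "\<And>x. x < M \<Longrightarrow> 0 \<le> \<sigma> * ?k x * (\<Prod>z\<in>Z. x - z)"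
    using sign_factorization[OF S(1) is_interval_io continuous_on_exp_poly S_def[symmetric]]
    by (simp only: lessThan_iff Ball_def) blast
  have fZ: "finite Z" using Z S finite_subset by blast
  have cZ: "card Z < card L" using card_mono[OF S(1) Z(1)] S(2) by linarith
  have "card Z + 1 = card L"
  proof (rule ccontr)
    assume ne: "card Z + 1 \<noteq> card L"
    \<comment> \<open>The sign pattern of \<open>?h\<close> is determined only if it has
      \<open>card L - 1\<close> zeros. Those missing after \<open>Z\<close> and \<open>M\<close> are
      placed beyond \<open>M\<close>, where they cause no sign change on the support.\<close>
    obtain E where E: "finite E" "card E = card L - 2 - card Z" "E \<subseteq> {M<..}"
      using infinite_arbitrarily_large[of "{M<..}"] infinite_Ioi by blast
    define Y where "Y = insert M E"
    have Y: "finite Y" "\<forall>y\<in>Y. M \<le> y" "M \<in> Y" using E by (auto simp: Y_def)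
    have "M \<notin> E" using E by auto
    then have cY: "card Y + card Z + 1 = card L" using E cZ ne by (simp add: Y_def)
    have dj: "Z \<inter> Y = {}" using Z(1) Y(2) unfolding S_def by fastforce
    have cZY: "card (Z \<union> Y) + 1 = 0 + card L" "finite (Z \<union> Y)"
      using card_Un_disjoint[OF fZ Y(1) dj] cY fZ Y(1) by simp_all
    obtain p b where pb: "\<forall>i\<ge>0. coeff p i = 0" "\<forall>x\<in>Z \<union> Y. exp_poly p b L x = 0"
      "p \<noteq> 0 \<or> (\<exists>l\<in>L. b l \<noteq> 0)"
      using exp_poly_interpolation[OF L(1,2) cZY(2), of 0] cZY(1) by (metis less_add_one)
    have p0: "p = 0" using pb(1) by (simp add: poly_eq_iff)
    let ?h = "exp_poly 0 b L"
    obtain \<tau> where t: "\<tau> \<in> {1, -1}" "\<And>x. x \<notin> Z \<union> Y \<Longrightarrow> 0 < \<tau> * ?h x * (\<Prod>s\<in>Z \<union> Y. x - s)"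
      using exp_poly_sign[OF L(1,2) pb(1,3) cZY(2) pb(2) cZY(1)] p0 by blast
    have neg: "(\<Prod>y\<in>Y. x - y) = (-1) ^ card Y * (\<Prod>y\<in>Y. y - x)" for x :: real
      by (subst prod_uminus[symmetric]) simp
    \<comment> \<open>All points of \<open>Y\<close> lie to the right of any \<open>x < M\<close>,
      so together they contribute the constant sign \<open>(-1) ^ card Y\<close>.\<close>
    define s where "s = \<sigma> * \<tau> * (-1) ^ card Y"
    have s: "s \<noteq> 0" using Z(2) t(1) by (auto simp: s_def)
    have kh: "0 \<le> s * (?k x * ?h x)" if "x < M" for x
    proof (cases "x \<in> Z")
      case True
      then show ?thesis using Z(1) S_def by auto
    next
      case False
      have xY: "x \<notin> Y" using that Y(2) by force
      let ?P = "\<Prod>z\<in>Z. x - z" and ?Q = "\<Prod>y\<in>Y. y - x"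
      have Q: "0 < ?Q" using that Y(2) by (intro prod_pos) force
      have P: "?P \<noteq> 0" using False fZ by auto
      have "0 \<le> (\<sigma> * ?k x * ?P) * (\<tau> * ?h x * (\<Prod>s\<in>Z \<union> Y. x - s))"
        using False xY by (intro mult_nonneg_nonneg[OF Z(3)[OF that] less_imp_le[OF t(2)]]) simp
      also have "\<dots> = (s * (?k x * ?h x)) * (?P\<^sup>2 * ?Q)"
        unfolding prod.union_disjoint[OF fZ Y(1) dj] neg s_def by (simp add: power2_eq_square mult_ac)
      finally have "0 * (?P\<^sup>2 * ?Q) \<le> (s * (?k x * ?h x)) * (?P\<^sup>2 * ?Q)" by simp
      moreover have "0 < ?P\<^sup>2 * ?Q" using P Q by simp
      ultimately show ?thesis by (rule mult_right_le_imp_le)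
    qed
    have hM: "?h M = 0" using pb(2) p0 Y(3) by blast
    \<comment> \<open>The integral of \<open>W a * (?k a * ?h a)\<close> is \<open>?h M = 0\<close>,
      and up to the factor \<open>s\<close> the integrand is nonnegative, so the product vanishes on
      \<open>T\<close>. Zeros of \<open>?h\<close> below \<open>M\<close> belong to
      \<open>Z\<close>, where \<open>?k\<close> vanishes too. Thus \<open>?k\<close> would have
      \<open>card T\<close> zeros, too many.\<close>
    have "?k t = 0" if "t \<in> T" for t
    proof -
      have tM: "t \<in> measure_support \<mu>" "t < M" using that T(2) M by auto
      have "W t * (s * (?k t * ?h t)) = 0"
      proof (rule integral_zero_support[OF _ _ _ tM(1)])
        show "continuous_on UNIV (\<lambda>a. W a * (s * (?k a * ?h a)))"
          by (intro continuous_intros W(1))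
        show "0 \<le> W a * (s * (?k a * ?h a))" if "a \<in> measure_support \<mu>" for a
          using that M by (intro mult_nonneg_nonneg[OF W(2)[OF that] kh]) auto
        have "(LINT a|\<mu>. W a * (s * (?k a * ?h a))) = s * (LINT a|\<mu>. W a * (?k a * ?h a))"
          by (subst integral_mult_right_zero[symmetric]) (simp add: mult.left_commute)
        then show "(LINT a|\<mu>. W a * (s * (?k a * ?h a))) = 0" using c(1)[of b] hM by simp
      qed
      then have "?k t = 0 \<or> ?h t = 0" using s T(3)[OF that] by auto
      moreover have "?k t = 0" if "?h t = 0"
      proof -
        have "t \<in> Z \<union> Y" using t(2)[of t] that by fastforce
        then have "t \<in> Z" using tM(2) Y(2) by force
        then show ?thesis using Z(1) S_def by blast
      qed
      ultimately show ?thesis by blast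
    qed
    then have "\<forall>l\<in>L. c l = 0"
      using exp_poly_zeros[OF L(1,2) _ T(1), of 0 0 c "{}"] L(3) by auto
    then show False using c0 by blast
  qed
  then show ?thesis using fZ Z(1) unfolding S_def by blast
qed

text \<open>For the representer \<open>k\<close> and its polynomial minorant \<open>q\<close>,
  \<open>C * (k M)\<^sup>2 = C * (poly q M)\<^sup>2\<close> is at most the weighted integral of
  \<open>q\<close> squared, hence of \<open>k\<close> squared, which is \<open>k M\<close>. So
  \<open>C * k M \<le> 1\<close>, and by Cauchy-Schwarz \<open>1 / k M\<close> is an admissible
  constant for every combination of the exponentials.\<close>

lemma exp_poly_extrapolation:
  assumes W: "continuous_on UNIV W" "\<And>a. a \<in> measure_support \<mu> \<Longrightarrow> 0 \<le> W a"
    and T: "finite T" "T \<subseteq> measure_support \<mu>" "\<And>t. t \<in> T \<Longrightarrow> 0 < W t"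
    and M: "measure_support \<mu> \<subseteq> {..<M}"
    and L: "finite L" "\<forall>l\<in>L. l < 0" "card L \<le> card T"
    and C: "\<And>q. (\<forall>i\<ge>card L. coeff q i = 0) \<Longrightarrow> C * (poly q M)\<^sup>2 \<le> (LINT a|\<mu>. W a * (poly q a)\<^sup>2)"
  shows "C * (exp_poly 0 b L M)\<^sup>2 \<le> (LINT a|\<mu>. W a * (exp_poly 0 b L a)\<^sup>2)"
proof (cases "L = {} \<or> C \<le> 0")
  case True
  have "C * (exp_poly 0 b L M)\<^sup>2 \<le> 0"
    using True by (auto simp: exp_poly_def mult_nonpos_nonneg)
  also have "0 \<le> (LINT a|\<mu>. W a * (exp_poly 0 b L a)\<^sup>2)"
    using W(2) by (intro integral_nonneg_support) simp
  finally show ?thesis .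
next
  case False
  then have L': "L \<noteq> {}" and C0: "0 < C" by auto
  have L0: "0 \<notin> L" using L(2) by auto
  obtain c where c: "\<And>b. (LINT a|\<mu>. W a * (exp_poly 0 c L a * exp_poly 0 b L a)) = exp_poly 0 b L M"
    "0 < exp_poly 0 c L M"
    using exp_poly_reproducing[OF W T L(1) L0 L' L(3)] by blast
  obtain Z where Z: "finite Z" "card Z + 1 = card L" "\<forall>x\<in>Z. x < M \<and> exp_poly 0 c L x = 0"
    using exp_poly_reproducing_zeros[OF W T M L(1) L0 L(3) c] by auto
  let ?k = "exp_poly 0 c L" and ?g = "exp_poly 0 b L"
  obtain q where q: "\<forall>i\<ge>card L. coeff q i = 0" "poly q M = ?k M" "\<forall>x\<le>M. \<bar>poly q x\<bar> \<le> \<bar>?k x\<bar>"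
    using exp_poly_polynomial_minorant[OF L(1,2) _ Z(1) _ Z(3) c(2), of 0] Z(2) by auto
  have "C * (?k M)\<^sup>2 \<le> (LINT a|\<mu>. W a * (poly q a)\<^sup>2)" using C[OF q(1)] q(2) by simp
  also have "\<dots> \<le> (LINT a|\<mu>. W a * (?k a * ?k a))"
  proof (rule integral_mono_support)
    fix a assume a: "a \<in> measure_support \<mu>"
    then have "\<bar>poly q a\<bar> \<le> \<bar>?k a\<bar>" using q(3) M by force
    then have "(poly q a)\<^sup>2 \<le> ?k a * ?k a" by (metis abs_le_square_iff power2_eq_square)
    then show "W a * (poly q a)\<^sup>2 \<le> W a * (?k a * ?k a)" using W(2)[OF a] by (intro mult_left_mono)
  qed (intro continuous_intros W(1))+
  finally have "C * (?k M)\<^sup>2 \<le> ?k M" using c(1) by simp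
  then have Ck: "C * ?k M \<le> 1" using c(2) by (simp add: power2_eq_square)
  have *: "(?g M)\<^sup>2 \<le> ?k M * (LINT a|\<mu>. W a * (?g a)\<^sup>2)"
    using weighted_Cauchy_Schwarz[of W ?k ?g] W c by (simp add: continuous_on_exp_poly)
  have "C * (?g M)\<^sup>2 \<le> C * (?k M * (LINT a|\<mu>. W a * (?g a)\<^sup>2))"
    using * C0 by (intro mult_left_mono) auto
  also have "\<dots> = (C * ?k M) * (LINT a|\<mu>. W a * (?g a)\<^sup>2)" by simp
  also have "\<dots> \<le> 1 * (LINT a|\<mu>. W a * (?g a)\<^sup>2)"
    using Ck W(2) by (intro mult_right_mono integral_nonneg_support) auto
  finally show ?thesis by simp
qed

end

section \<open>Positive semidefinite forms\<close>

text \<open>Entries with an index beyond \<open>m\<close> are ignored, so passing to a leading block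
  only changes \<open>m\<close>.\<close>

definition psd_form :: "nat \<Rightarrow> (nat \<Rightarrow> nat \<Rightarrow> real) \<Rightarrow> bool" where
  "psd_form m A \<longleftrightarrow> (\<forall>i<m. \<forall>j<m. A i j = A j i) \<and>
     (\<forall>z. 0 \<le> (\<Sum>i<m. \<Sum>j<m. z i * z j * A i j))"

lemma psd_form_rank_one: "psd_form m (\<lambda>i j. u i * u j)"
proof -
  have "(\<Sum>i<m. \<Sum>j<m. z i * z j * (u i * u j)) = (\<Sum>i<m. z i * u i)\<^sup>2" for z
    by (simp add: power2_eq_square sum_product mult_ac)
  then show ?thesis by (simp add: psd_form_def mult.commute)
qed

lemma psd_form_add:
  assumes "psd_form m A" "psd_form m B"
  shows "psd_form m (\<lambda>i j. A i j + B i j)"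
  unfolding psd_form_def
proof (intro conjI allI impI)
  fix z :: "nat \<Rightarrow> real"
  have "0 \<le> (\<Sum>i<m. \<Sum>j<m. z i * z j * A i j) + (\<Sum>i<m. \<Sum>j<m. z i * z j * B i j)"
    using assms unfolding psd_form_def by (meson add_nonneg_nonneg)
  then show "0 \<le> (\<Sum>i<m. \<Sum>j<m. z i * z j * (A i j + B i j))"
    by (simp add: distrib_left sum.distrib)
qed (use assms in \<open>simp add: psd_form_def\<close>)

lemma psd_form_scale:
  assumes "psd_form m A" "0 \<le> t"
  shows "psd_form m (\<lambda>i j. t * A i j)"
  unfolding psd_form_def
proof (intro conjI allI impI)
  fix z :: "nat \<Rightarrow> real"
  have "0 \<le> t * (\<Sum>i<m. \<Sum>j<m. z i * z j * A i j)"
    using assms unfolding psd_form_def by (meson mult_nonneg_nonneg)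
  then show "0 \<le> (\<Sum>i<m. \<Sum>j<m. z i * z j * (t * A i j))"
    by (simp add: sum_distrib_left mult.left_commute)
qed (use assms in \<open>simp add: psd_form_def\<close>)

lemma psd_form_diag:
  assumes "psd_form m A" "k < m" shows "0 \<le> A k k"
proof -
  have "0 \<le> (\<Sum>i<m. \<Sum>j<m. (if i = k then 1 else 0) * (if j = k then 1 else 0) * A i j)"
    using assms unfolding psd_form_def by (elim conjE) (erule allE)
  also have "\<dots> = (\<Sum>i<m. \<Sum>j<m. if j = k then if i = k then A k k else 0 else 0)"
    by (intro sum.cong refl) auto
  also have "\<dots> = A k k" using assms(2) by simp
  finally show ?thesis .
qed

lemma psd_form_schur_complement:
  assumes A: "psd_form (Suc m) A" and pos: "0 < A m m"
  defines "v \<equiv> \<lambda>i. A i m / sqrt (A m m)"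
  shows "psd_form m (\<lambda>i j. A i j - v i * v j)"
  unfolding psd_form_def
proof (intro conjI allI impI)
  fix z :: "nat \<Rightarrow> real"
  define S where "S = (\<Sum>i<m. z i * A i m)"
  \<comment> \<open>The last coordinate that minimises the form when the others are given by
    \<open>z\<close>; inserting it completes the square.\<close>
  define z' where "z' = z(m := - S / A m m)"
  have sym: "A m j = A j m" if "j < m" for j using A that by (simp add: psd_form_def)
  have Sm: "(\<Sum>j<m. z' m * z j * A m j) = z' m * S"
    unfolding S_def sum_distrib_left using sym by (intro sum.cong) auto
  have "0 \<le> (\<Sum>i<Suc m. \<Sum>j<Suc m. z' i * z' j * A i j)" using A unfolding psd_form_def by blast
  also have "\<dots> = (\<Sum>i<m. \<Sum>j<m. z' i * z' j * A i j) + (\<Sum>i<m. z' i * z' m * A i m) +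
      ((\<Sum>j<m. z' m * z' j * A m j) + z' m * z' m * A m m)"
    by (simp add: sum.distrib)
  also have "\<dots> = (\<Sum>i<m. \<Sum>j<m. z i * z j * A i j) + (\<Sum>i<m. z i * z' m * A i m) +
      ((\<Sum>j<m. z' m * z j * A m j) + z' m * z' m * A m m)"
    by (intro arg_cong2[where f = "(+)"] sum.cong refl) (simp_all add: z'_def)
  also have "(\<Sum>i<m. z i * z' m * A i m) = z' m * S"
    by (simp add: S_def sum_distrib_left mult_ac)
  also have "(\<Sum>i<m. \<Sum>j<m. z i * z j * A i j) + z' m * S + ((\<Sum>j<m. z' m * z j * A m j) + z' m * z' m * A m m)
      = (\<Sum>i<m. \<Sum>j<m. z i * z j * A i j) - S\<^sup>2 / A m m"
    unfolding Sm using pos by (simp add: z'_def power2_eq_square field_simps)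
  also have "S\<^sup>2 / A m m = (\<Sum>i<m. z i * v i)\<^sup>2"
    using pos by (simp add: v_def S_def power_divide flip: sum_divide_distrib)
  also have "(\<Sum>i<m. z i * v i)\<^sup>2 = (\<Sum>i<m. \<Sum>j<m. z i * z j * (v i * v j))"
    by (simp add: power2_eq_square sum_product mult_ac)
  finally show "0 \<le> (\<Sum>i<m. \<Sum>j<m. z i * z j * (A i j - v i * v j))"
    by (simp add: right_diff_distrib sum_subtractf)
next
  fix i j assume "i < m" "j < m"
  then show "A i j - v i * v j = A j i - v j * v i" using A by (simp add: psd_form_def)
qed

lemma psd_form_zero_diag:
  assumes A: "psd_form (Suc m) A" and "A m m = 0" "i < m"
  shows "A i m = 0"
proof (rule ccontr)
  assume ne: "A i m \<noteq> 0"
  \<comment> \<open>Chosen so that \<open>A i i + 2 * s * A i m = -1\<close>, the value of the form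
    at \<open>z\<close> since the last diagonal entry is 0.\<close>
  define s where "s = - (A i i + 1) / (2 * A i m)"
  define z where "z k = (if k = i then 1 else if k = m then s else 0)" for k
  have sym: "A m i = A i m" using A assms(3) by (simp add: psd_form_def)
  have r: "(\<Sum>k<Suc m. f k) = f i + f m" if "\<And>k. k \<noteq> i \<Longrightarrow> k \<noteq> m \<Longrightarrow> f k = 0" for f :: "nat \<Rightarrow> real"
  proof -
    have "(\<Sum>k<Suc m. f k) = (\<Sum>k\<in>{i, m}. f k)"
      using assms(3) that by (intro sum.mono_neutral_right) auto
    then show ?thesis using assms(3) by simp
  qed
  have "0 \<le> (\<Sum>k<Suc m. \<Sum>l<Suc m. z k * z l * A k l)" using A unfolding psd_form_def by blast
  also have "\<dots> = (\<Sum>l<Suc m. z i * z l * A i l) + (\<Sum>l<Suc m. z m * z l * A m l)"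
    by (rule r) (simp add: z_def)
  also have "(\<Sum>l<Suc m. z i * z l * A i l) = z i * z i * A i i + z i * z m * A i m"
    by (rule r) (simp add: z_def)
  also have "(\<Sum>l<Suc m. z m * z l * A m l) = z m * z i * A m i + z m * z m * A m m"
    by (rule r) (simp add: z_def)
  also have "z i * z i * A i i + z i * z m * A i m + (z m * z i * A m i + z m * z m * A m m) = - 1"
    using ne assms by (simp add: z_def s_def sym field_simps)
  finally show False by simp
qed

text \<open>One Cholesky step. For a zero pivot the whole last row and column vanish, so
  \<open>v = 0\<close> serves.\<close>

lemma psd_form_decompose:
  assumes "psd_form (Suc m) A"
  shows "\<exists>v B. psd_form m B \<and> (\<forall>i\<le>m. \<forall>j\<le>m. A i j = v i * v j + B i j) \<and>
    (\<forall>i\<le>m. B i m = 0 \<and> B m i = 0)"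
proof (cases "A m m = 0")
  case True
  have sym: "A m i = A i m" if "i \<le> m" for i
    using assms that by (simp add: psd_form_def less_Suc_eq_le)
  have z: "A i m = 0" "A m i = 0" if "i \<le> m" for i
    using psd_form_zero_diag[OF assms True, of i] True sym[OF that] that by (cases "i = m"; simp)+
  have "psd_form m A" unfolding psd_form_def
  proof (intro conjI allI impI)
    fix x :: "nat \<Rightarrow> real"
    have "0 \<le> (\<Sum>i<Suc m. \<Sum>j<Suc m. x i * x j * A i j)" using assms unfolding psd_form_def by blast
    then show "0 \<le> (\<Sum>i<m. \<Sum>j<m. x i * x j * A i j)" using z by simp
  qed (use assms in \<open>simp add: psd_form_def\<close>)
  then show ?thesis using z by (intro exI[of _ "\<lambda>_. 0"] exI[of _ A]) auto
next
  case False
  then have pos: "0 < A m m" using psd_form_diag[OF assms, of m] by simp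
  have sym: "A m i = A i m" if "i \<le> m" for i using assms that by (simp add: psd_form_def less_Suc_eq_le)
  define v where "v = (\<lambda>i. A i m / sqrt (A m m))"
  define B where "B = (\<lambda>i j. A i j - v i * v j)"
  have "psd_form m B" using psd_form_schur_complement[OF assms pos] by (simp add: B_def v_def)
  moreover have "\<forall>i\<le>m. \<forall>j\<le>m. A i j = v i * v j + B i j" by (simp add: B_def)
  moreover have "B i m = 0 \<and> B m i = 0" if "i \<le> m" for i
    using pos sym[OF that] by (simp add: B_def v_def)
  ultimately show ?thesis by blast
qed

text \<open>Splitting \<open>A\<close> as a rank-one part plus a form of smaller size: the entrywise
  product of \<open>C\<close> with \<open>v i * v j\<close> is a congruence of \<open>C\<close> by a
  diagonal matrix, and the rest is the induction hypothesis.\<close>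

lemma psd_form_schur_product:
  "psd_form m A \<Longrightarrow> psd_form m C \<Longrightarrow> psd_form m (\<lambda>i j. A i j * C i j)"
proof (induction m arbitrary: A C)
  case 0
  then show ?case by (simp add: psd_form_def)
next
  case (Suc m)
  obtain v B where v: "psd_form m B" "\<And>i j. i \<le> m \<Longrightarrow> j \<le> m \<Longrightarrow> A i j = v i * v j + B i j"
    and z: "\<And>i. i \<le> m \<Longrightarrow> B i m = 0" "\<And>i. i \<le> m \<Longrightarrow> B m i = 0"
    using psd_form_decompose[OF Suc.prems(1)] by metis
  have C: "psd_form m C" unfolding psd_form_def
  proof (intro conjI allI impI)
    fix x :: "nat \<Rightarrow> real"
    have "0 \<le> (\<Sum>i<Suc m. \<Sum>j<Suc m. (x(m := 0)) i * (x(m := 0)) j * C i j)"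
      using Suc.prems(2) unfolding psd_form_def by blast
    then show "0 \<le> (\<Sum>i<m. \<Sum>j<m. x i * x j * C i j)" by simp
  qed (use Suc.prems(2) in \<open>simp add: psd_form_def\<close>)
  show ?case unfolding psd_form_def
  proof (intro conjI allI impI)
    fix x :: "nat \<Rightarrow> real"
    have b: "0 \<le> (\<Sum>i<m. \<Sum>j<m. x i * x j * (B i j * C i j))"
      using Suc.IH[OF v(1) C] unfolding psd_form_def by blast
    have c: "0 \<le> (\<Sum>i<Suc m. \<Sum>j<Suc m. (x i * v i) * (x j * v j) * C i j)"
      using Suc.prems(2) unfolding psd_form_def by (elim conjE) (erule allE[where x = "\<lambda>i. x i * v i"])
    have "(\<Sum>i<Suc m. \<Sum>j<Suc m. x i * x j * (A i j * C i j)) =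
      (\<Sum>i<Suc m. \<Sum>j<Suc m. (x i * v i) * (x j * v j) * C i j + x i * x j * (B i j * C i j))"
      by (intro sum.cong refl) (simp add: v(2) algebra_simps)
    also have "\<dots> = (\<Sum>i<Suc m. \<Sum>j<Suc m. (x i * v i) * (x j * v j) * C i j) +
       (\<Sum>i<Suc m. \<Sum>j<Suc m. x i * x j * (B i j * C i j))"
      by (simp only: sum.distrib)
    also have "(\<Sum>i<Suc m. \<Sum>j<Suc m. x i * x j * (B i j * C i j)) = (\<Sum>i<m. \<Sum>j<m. x i * x j * (B i j * C i j))"
      using z by simp
    finally show "0 \<le> (\<Sum>i<Suc m. \<Sum>j<Suc m. x i * x j * (A i j * C i j))"
      using add_nonneg_nonneg[OF c b] by linarith
  qed (use Suc.prems in \<open>simp add: psd_form_def\<close>)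
qed

text \<open>The segment from the rank-one matrix \<open>u u\<^sup>T\<close>, where \<open>u\<close> is the rescaled last column, to \<open>A\<close>
  moves only the leading block, so the derivative along it is a form of dimension \<open>m\<close>.\<close>
lemma psd_form_extension:
  fixes f f' :: "real \<Rightarrow> real" and I :: "real set"
  assumes I: "convex I" "\<And>x. x \<in> I \<Longrightarrow> 0 < x" "\<And>x y. x \<in> I \<Longrightarrow> 0 < y \<Longrightarrow> y \<le> x \<Longrightarrow> y \<in> I"
    and der: "\<And>x. x \<in> I \<Longrightarrow> (f has_real_derivative f' x) (at x)"
    and rank_one: "\<And>u z. (\<And>i. i \<le> m \<Longrightarrow> 0 < u i) \<Longrightarrow> (\<And>i j. i \<le> m \<Longrightarrow> j \<le> m \<Longrightarrow> u i * u j \<in> I) \<Longrightarrow>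
       0 \<le> (\<Sum>i<Suc m. \<Sum>j<Suc m. z i * z j * f (u i * u j))"
    and block: "\<And>A. psd_form m A \<Longrightarrow> (\<And>i j. i < m \<Longrightarrow> j < m \<Longrightarrow> A i j \<in> I) \<Longrightarrow> psd_form m (\<lambda>i j. f' (A i j))"
    and A: "psd_form (Suc m) A" "\<And>i j. i \<le> m \<Longrightarrow> j \<le> m \<Longrightarrow> A i j \<in> I"
  shows "psd_form (Suc m) (\<lambda>i j. f (A i j))"
  unfolding psd_form_def
proof (intro conjI allI impI)
  fix z :: "nat \<Rightarrow> real"
  define a where "a = A m m"
  have a: "0 < a" using A(2) I(2) a_def by blast
  define u where "u = (\<lambda>i. A i m / sqrt a)"
  define B where "B = (\<lambda>i j. A i j - u i * u j)"
  have u: "0 < u i" if "i \<le> m" for i using A(2)[of i m] I(2) a that by (simp add: u_def)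
  have B: "psd_form m B"
    using psd_form_schur_complement[OF A(1)] a unfolding B_def u_def a_def by blast
  have sym: "A i j = A j i" if "i \<le> m" "j \<le> m" for i j
    using A(1) that by (simp add: psd_form_def less_Suc_eq_le)
  have Bz: "B i m = 0" "B m i = 0" if "i \<le> m" for i
    using a that sym[of i m] by (simp_all add: B_def u_def a_def)
  have uu: "u i * u i \<le> A i i" if "i \<le> m" for i
    using psd_form_diag[OF B, of i] Bz[OF that] that unfolding B_def by (cases "i = m") auto
  \<comment> \<open>An off-diagonal product \<open>u i * u j\<close> may exceed
    \<open>A i j\<close>, but it is at most the larger of two diagonal entries of \<open>A\<close>,
    and \<open>I\<close> is closed downwards among positive numbers.\<close>
  have uI: "u i * u j \<in> I" if "i \<le> m" "j \<le> m" for i j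
  proof -
    have "u i * u j \<le> max (u i) (u j) * max (u i) (u j)"
      using u[OF that(1)] u[OF that(2)] by (intro mult_mono) auto
    also have "\<dots> \<le> max (A i i) (A j j)"
      using uu[OF that(1)] uu[OF that(2)] by (auto simp: max_def)
    finally have "u i * u j \<le> max (A i i) (A j j)" .
    moreover have "max (A i i) (A j j) \<in> I" using A(2) that by (auto simp: max_def)
    ultimately show ?thesis using I(3) u that by simp
  qed
  define P where "P t i j = u i * u j + t * B i j" for t i j
  have PI: "P t i j \<in> I" if "0 \<le> t" "t \<le> 1" "i \<le> m" "j \<le> m" for t i j
  proof -
    have "P t i j = (1 - t) *\<^sub>R (u i * u j) + t *\<^sub>R A i j" by (simp add: P_def B_def algebra_simps)
    then show ?thesis using convexD[OF I(1) uI A(2), of i j i j "1 - t" t] that by simp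
  qed
  define \<phi> where "\<phi> t = (\<Sum>i<Suc m. \<Sum>j<Suc m. z i * z j * f (P t i j))" for t
  have "\<phi> 0 \<le> \<phi> 1"
  proof (rule DERIV_nonneg_imp_nondecreasing[of 0 1 \<phi>])
    fix t :: real assume t: "0 \<le> t" "t \<le> 1"
    let ?d = "\<Sum>i<Suc m. \<Sum>j<Suc m. z i * z j * (f' (P t i j) * B i j)"
    have "(\<phi> has_real_derivative ?d) (at t)" unfolding \<phi>_def
    proof (intro DERIV_sum DERIV_cmult)
      fix i j assume "i \<in> {..<Suc m}" "j \<in> {..<Suc m}"
      then have ij: "i \<le> m" "j \<le> m" by auto
      have "((\<lambda>t. P t i j) has_real_derivative B i j) (at t)"
        unfolding P_def by (auto intro!: derivative_eq_intros)
      then show "((\<lambda>t. f (P t i j)) has_real_derivative f' (P t i j) * B i j) (at t)"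
        by (rule DERIV_chain2[where f = f and g = "\<lambda>t. P t i j", OF der[OF PI[OF t ij]]])
    qed
    \<comment> \<open>The derivative is the form of the entrywise product of \<open>f'\<close>
      applied to \<open>P t\<close> with \<open>B\<close>, so the Schur product theorem
      applies.\<close>
    moreover have "0 \<le> ?d"
    proof -
      have "psd_form m (P t)"
        unfolding P_def by (intro psd_form_add psd_form_rank_one psd_form_scale B t)
      then have "psd_form m (\<lambda>i j. f' (P t i j))" using PI[OF t] by (intro block) auto
      then have "psd_form m (\<lambda>i j. f' (P t i j) * B i j)" using B by (rule psd_form_schur_product)
      then have "0 \<le> (\<Sum>i<m. \<Sum>j<m. z i * z j * (f' (P t i j) * B i j))" unfolding psd_form_def by blast
      also have "\<dots> = ?d" using Bz by simp
      finally show ?thesis .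
    qed
    ultimately show "\<exists>y. (\<phi> has_real_derivative y) (at t) \<and> 0 \<le> y" by blast
  qed simp
  moreover have "0 \<le> \<phi> 0"
    using rank_one[of u z, OF u uI] by (simp add: \<phi>_def P_def)
  ultimately show "0 \<le> (\<Sum>i<Suc m. \<Sum>j<Suc m. z i * z j * f (A i j))"
    by (simp add: \<phi>_def P_def B_def)
qed (use A(1) in \<open>simp add: psd_form_def\<close>)

section \<open>Derivatives\<close>

text \<open>The falling factorial, the factor that \<open>k\<close> differentiations of
  \<open>x powr a\<close> produce.\<close>

definition falling :: "nat \<Rightarrow> real \<Rightarrow> real" where
  "falling k a = (\<Prod>j<k. a - real j)"

lemma falling_simps [simp]: "falling 0 a = 1" "falling (Suc k) a = falling k a * (a - real k)"
  by (simp_all add: falling_def)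

lemma continuous_on_falling [continuous_intros]: "continuous_on A (falling k)"
  unfolding falling_def by (intro continuous_intros)

lemma falling_pos: "real k - 1 < a \<Longrightarrow> 0 < falling k a"
  unfolding falling_def by (intro prod_pos) auto

text \<open>The reason for the shape of \<open>exponents n\<close>: an integer below
  \<open>k\<close> is a zero of \<open>falling k\<close>, and any exponent that is not an integer is
  at least \<open>n - 2 \<ge> k - 1\<close>, so that every factor is nonnegative.\<close>

lemma falling_exponents:
  assumes "a \<in> exponents n" "k < n"
  shows "falling k a = 0 \<or> real k - 1 \<le> a"
proof (cases "real k - 1 \<le> a")
  case False
  then have "a \<in> \<nat>" using assms unfolding exponents_def by auto
  then obtain m where "a = real m" by (auto elim: Nats_cases)
  with False have "falling k a = 0" unfolding falling_def by (intro prod_zero) (auto intro!: bexI[of _ m])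
  then show ?thesis ..
qed simp

lemma falling_nonneg:
  assumes "a \<in> exponents n" "k < n" shows "0 \<le> falling k a"
proof -
  have "0 \<le> falling k a" if "real k - 1 \<le> a"
    unfolding falling_def using that by (intro prod_nonneg) auto
  then show ?thesis using falling_exponents[OF assms] by auto
qed

lemma falling_mono:
  assumes "a \<in> exponents n" "k < n" "a \<le> M" "real n - 2 < M"
  shows "falling k a \<le> falling k M"
proof -
  have "falling k a \<le> falling k M" if "real k - 1 \<le> a"
    unfolding falling_def using that assms(3) by (intro prod_mono) auto
  moreover have "0 < falling k M" using assms by (intro falling_pos) auto
  ultimately show ?thesis using falling_exponents[OF assms(1,2)] by auto
qed

lemma falling_eq_0_iff: "falling k a = 0 \<longleftrightarrow> a \<in> real ` {..<k}"
  by (auto simp: falling_def)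

lemma falling_poly: "\<exists>p. degree p \<le> k \<and> (\<forall>a. poly p a = falling k a)"
proof (induction k)
  case 0
  show ?case by (intro exI[of _ 1]) simp
next
  case (Suc k)
  then obtain p where p: "degree p \<le> k" "\<forall>a. poly p a = falling k a" by blast
  have "degree (p * [:- real k, 1:]) \<le> Suc k"
    by (rule order.trans[OF degree_mult_le]) (use p in simp)
  with p show ?case by (intro exI[of _ "p * [:- real k, 1:]"]) (auto simp: algebra_simps)
qed

context compact_support_measure
begin

text \<open>Differentiation under the integral by dominated convergence along sequences, which are
  kept in \<open>{x / 2<..<2 * x}\<close> to stay away from 0.\<close>

lemma DERIV_integral_powr:
  assumes h: "continuous_on UNIV h" and x: "0 < x"
  shows "((\<lambda>x. LINT a|\<mu>. h a * x powr (a - b)) has_real_derivative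
    (LINT a|\<mu>. h a * ((a - b) * x powr (a - b - 1)))) (at x)"
proof -
  let ?F = "\<lambda>x. LINT a|\<mu>. h a * x powr (a - b)"
  define S where "S = {x / 2<..<2 * x}"
  have S: "open S" "x \<in> S" using x by (auto simp: S_def)
  have der: "((\<lambda>y. y powr \<beta>) has_real_derivative \<beta> * y powr (\<beta> - 1)) (at y)" if "0 < y" for y \<beta> :: real
    using that by (auto intro!: derivative_eq_intros)
  have int: "integrable \<mu> (\<lambda>a. h a * y powr (a - b))" if "0 < y" for y
    using that by (intro integrable_continuous continuous_intros h) auto
  have "((\<lambda>y. (?F y - ?F x) / (y - x)) \<longlongrightarrow> (LINT a|\<mu>. h a * ((a - b) * x powr (a - b - 1)))) (at x within S)"
    unfolding tendsto_at_iff_sequentially comp_def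
  proof (intro allI impI)
    fix X assume X: "\<forall>i. X i \<in> S - {x}" "X \<longlonglongrightarrow> x"
    have Xpos: "0 < X i" "x / 2 < X i" "X i < 2 * x" "X i \<noteq> x" for i
      using X(1)[rule_format, of i] x by (auto simp: S_def)
    define s where "s i a = h a * ((X i powr (a - b) - x powr (a - b)) / (X i - x))" for i a
    \<comment> \<open>By the mean value theorem a difference quotient is
      \<open>(a - b) * z powr (a - b - 1)\<close>. That power increases or decreases in
      \<open>z\<close> according to the sign of the exponent, and the sum of the two end values
      bounds it in both cases.\<close>
    define w where "w a = \<bar>h a\<bar> * (\<bar>a - b\<bar> * ((x / 2) powr (a - b - 1) + (2 * x) powr (a - b - 1)))" for a
    have "(\<lambda>i. LINT a|\<mu>. s i a) \<longlonglongrightarrow> (LINT a|\<mu>. h a * ((a - b) * x powr (a - b - 1)))"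
    proof (rule integral_dominated_convergence[where w = w])
      show "integrable \<mu> w" unfolding w_def using x by (intro integrable_continuous continuous_intros h) auto
      show "(\<lambda>a. h a * ((a - b) * x powr (a - b - 1))) \<in> borel_measurable \<mu>"
        using x by (intro measurable_continuous continuous_intros h) auto
      show "s i \<in> borel_measurable \<mu>" for i
        unfolding s_def using x Xpos[of i] by (intro measurable_continuous continuous_intros h) auto
      show "AE a in \<mu>. (\<lambda>i. s i a) \<longlonglongrightarrow> h a * ((a - b) * x powr (a - b - 1))"
      proof (rule AE_I2)
        fix a
        have "((\<lambda>y. (y powr (a - b) - x powr (a - b)) / (y - x)) \<longlongrightarrow> (a - b) * x powr (a - b - 1)) (at x)"
          using der[OF x, of "a - b"] by (simp add: has_field_derivative_iff)
        then have "(\<lambda>i. (X i powr (a - b) - x powr (a - b)) / (X i - x)) \<longlonglongrightarrow> (a - b) * x powr (a - b - 1)"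
          using X unfolding tendsto_at_iff_sequentially comp_def by blast
        then show "(\<lambda>i. s i a) \<longlonglongrightarrow> h a * ((a - b) * x powr (a - b - 1))"
          unfolding s_def by (rule tendsto_mult_left)
      qed
      show "AE a in \<mu>. norm (s i a) \<le> w a" for i
      proof (rule AE_I2)
        fix a
        let ?\<beta> = "a - b"
        have "\<exists>z. min x (X i) < z \<and> z < max x (X i) \<and>
          (X i powr ?\<beta> - x powr ?\<beta>) / (X i - x) = ?\<beta> * z powr (?\<beta> - 1)"
        proof (cases "x < X i")
          case True
          then obtain z where "x < z" "z < X i" "X i powr ?\<beta> - x powr ?\<beta> = (X i - x) * (?\<beta> * z powr (?\<beta> - 1))"
            using MVT2[OF True, of "\<lambda>y. y powr ?\<beta>" "\<lambda>y. ?\<beta> * y powr (?\<beta> - 1)"] der x by auto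
          then show ?thesis using True by (intro exI[of _ z]) auto
        next
          case False
          then have lt: "X i < x" using Xpos(4)[of i] by simp
          then obtain z where "X i < z" "z < x" "x powr ?\<beta> - X i powr ?\<beta> = (x - X i) * (?\<beta> * z powr (?\<beta> - 1))"
            using MVT2[OF lt, of "\<lambda>y. y powr ?\<beta>" "\<lambda>y. ?\<beta> * y powr (?\<beta> - 1)"] der Xpos(1)[of i] by auto
          moreover from this have "(X i powr ?\<beta> - x powr ?\<beta>) / (X i - x) = ?\<beta> * z powr (?\<beta> - 1)"
            using lt by (simp add: field_simps)
          ultimately show ?thesis using lt by (intro exI[of _ z]) auto
        qed
        then obtain z where z: "min x (X i) < z" "z < max x (X i)"
          "(X i powr ?\<beta> - x powr ?\<beta>) / (X i - x) = ?\<beta> * z powr (?\<beta> - 1)" by blast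
        have zb: "x / 2 \<le> z" "z \<le> 2 * x" "0 < z" using z(1,2) Xpos[of i] x by (auto simp: min_def max_def split: if_splits)
        have "z powr (?\<beta> - 1) \<le> (x / 2) powr (?\<beta> - 1) + (2 * x) powr (?\<beta> - 1)"
        proof (cases "0 \<le> ?\<beta> - 1")
          case True
          then have "z powr (?\<beta> - 1) \<le> (2 * x) powr (?\<beta> - 1)" using zb by (intro powr_mono2) auto
          then show ?thesis by (simp add: add_increasing)
        next
          case False
          then have "z powr (?\<beta> - 1) \<le> (x / 2) powr (?\<beta> - 1)" using zb x by (intro powr_mono2') auto
          then show ?thesis by (simp add: add_increasing2)
        qed
        then show "norm (s i a) \<le> w a"
          unfolding s_def w_def z(3) by (simp add: abs_mult mult_left_mono)
      qed
    qed
    moreover have "(?F (X i) - ?F x) / (X i - x) = (LINT a|\<mu>. s i a)" for i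
    proof -
      have "?F (X i) - ?F x = (LINT a|\<mu>. h a * X i powr (a - b) - h a * x powr (a - b))"
        using int Xpos(1) x by simp
      then show ?thesis
        by (simp add: s_def right_diff_distrib diff_divide_distrib flip: integral_divide_zero)
    qed
    ultimately show "(\<lambda>i. (?F (X i) - ?F x) / (X i - x)) \<longlonglongrightarrow> (LINT a|\<mu>. h a * ((a - b) * x powr (a - b - 1)))"
      by simp
  qed
  then show ?thesis using at_within_open[OF S(2,1)] by (simp add: has_field_derivative_iff)
qed

text \<open>The \<open>k\<close>-th derivative of \<open>F_fun \<mu> x - c * x powr M\<close>.\<close>
definition diff_fun :: "real \<Rightarrow> real \<Rightarrow> nat \<Rightarrow> real \<Rightarrow> real" where
  "diff_fun c M k x = (LINT a|\<mu>. falling k a * x powr (a - real k)) - c * (falling k M * x powr (M - real k))"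

lemma DERIV_diff_fun:
  assumes "0 < x"
  shows "(diff_fun c M k has_real_derivative diff_fun c M (Suc k) x) (at x)"
proof -
  have "((\<lambda>x. falling k M * x powr (M - real k)) has_real_derivative
      falling k M * ((M - real k) * x powr (M - real k - 1))) (at x)"
    using assms by (auto intro!: derivative_eq_intros)
  from DERIV_diff[OF DERIV_integral_powr[OF continuous_on_falling assms, of k "real k"] DERIV_cmult[OF this, of c]]
  have "(diff_fun c M k has_real_derivative (LINT a|\<mu>. falling k a * ((a - real k) * x powr (a - real k - 1))) -
      c * (falling k M * ((M - real k) * x powr (M - real k - 1)))) (at x)"
    unfolding diff_fun_def .
  then show ?thesis by (simp add: diff_fun_def mult.assoc diff_diff_eq add.commute)
qed

text \<open>For a fixed exponent the power of \<open>u i * u j\<close> factors, so its form is the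
  square of \<open>g\<close>; the sum is then exchanged with the integral.\<close>

lemma diff_fun_rank_one_form:
  fixes z u :: "nat \<Rightarrow> real" and k :: nat
  assumes u: "\<And>i. i < m \<Longrightarrow> 0 < u i"
  defines "g \<equiv> \<lambda>a. \<Sum>i<m. z i * u i powr (a - real k)"
  shows "(\<Sum>i<m. \<Sum>j<m. z i * z j * diff_fun c M k (u i * u j)) =
    (LINT a|\<mu>. falling k a * (g a)\<^sup>2) - c * (falling k M * (g M)\<^sup>2)"
proof -
  have int: "integrable \<mu> (\<lambda>a. falling k a * (u i * u j) powr (a - real k))" if "i < m" "j < m" for i j
    using u[OF that(1)] u[OF that(2)] by (intro integrable_continuous continuous_intros) auto
  have sq: "(\<Sum>i<m. \<Sum>j<m. z i * z j * (falling k a * (u i * u j) powr (a - real k))) = falling k a * (g a)\<^sup>2" for a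
  proof -
    have "(\<Sum>i<m. \<Sum>j<m. z i * z j * (falling k a * (u i * u j) powr (a - real k))) =
      (\<Sum>i<m. \<Sum>j<m. falling k a * ((z i * u i powr (a - real k)) * (z j * u j powr (a - real k))))"
      using u by (intro sum.cong refl) (simp add: powr_mult less_imp_le)
    then show ?thesis by (simp add: g_def power2_eq_square sum_product flip: sum_distrib_left)
  qed
  have "(LINT a|\<mu>. (\<Sum>i<m. \<Sum>j<m. z i * z j * (falling k a * (u i * u j) powr (a - real k)))) =
    (\<Sum>i<m. LINT a|\<mu>. (\<Sum>j<m. z i * z j * (falling k a * (u i * u j) powr (a - real k))))"
    using int by (intro Bochner_Integration.integral_sum Bochner_Integration.integrable_sum integrable_mult_right) auto
  also have "\<dots> = (\<Sum>i<m. \<Sum>j<m. LINT a|\<mu>. z i * z j * (falling k a * (u i * u j) powr (a - real k)))"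
    using int by (intro sum.cong refl Bochner_Integration.integral_sum integrable_mult_right) auto
  also have "\<dots> = (\<Sum>i<m. \<Sum>j<m. z i * z j * (LINT a|\<mu>. falling k a * (u i * u j) powr (a - real k)))"
    by (simp only: integral_mult_right_zero)
  finally have "(\<Sum>i<m. \<Sum>j<m. z i * z j * (LINT a|\<mu>. falling k a * (u i * u j) powr (a - real k))) =
    (LINT a|\<mu>. falling k a * (g a)\<^sup>2)"
    by (simp only: sq)
  moreover have "(\<Sum>i<m. \<Sum>j<m. z i * z j * (c * (falling k M * (u i * u j) powr (M - real k)))) =
    c * (falling k M * (g M)\<^sup>2)"
    unfolding sq[of M, symmetric] by (simp only: sum_distrib_left mult.left_commute[of _ c])
  ultimately show ?thesis
    unfolding diff_fun_def right_diff_distrib sum_subtractf by simp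
qed

end

section \<open>The bound on polynomials\<close>

text \<open>The \<open>u i\<close> of a rank-one matrix may coincide, so terms of equal frequency
  are collected.\<close>

lemma exp_poly_image_sum:
  assumes "finite A"
  shows "(\<Sum>i\<in>A. w i * exp (\<nu> i * x)) = exp_poly 0 (\<lambda>l. \<Sum>i\<in>{i\<in>A. \<nu> i = l}. w i) (\<nu> ` A) x"
proof -
  have "(\<Sum>i\<in>A. w i * exp (\<nu> i * x)) = (\<Sum>l\<in>\<nu> ` A. \<Sum>i\<in>{i\<in>A. \<nu> i = l}. w i * exp (\<nu> i * x))"
    by (rule sum.image_gen[OF assms])
  also have "\<dots> = (\<Sum>l\<in>\<nu> ` A. (\<Sum>i\<in>{i\<in>A. \<nu> i = l}. w i) * exp (l * x))"
    by (intro sum.cong refl) (simp add: sum_distrib_right)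
  finally show ?thesis by (simp add: exp_poly_def)
qed

context compact_support_measure
begin

text \<open>In terms of coefficient vectors: \<open>G_mat n \<mu> r\<close> minus
  \<open>c * r powr M\<close> times \<open>v v\<^sup>T\<close>, with
  \<open>v = power_vec n M\<close>, is positive semidefinite.\<close>

definition polynomial_bound :: "nat \<Rightarrow> real \<Rightarrow> real \<Rightarrow> real \<Rightarrow> bool" where
  "polynomial_bound n c M r \<longleftrightarrow> (\<forall>p. (\<forall>i\<ge>n. coeff p i = 0) \<longrightarrow>
     c * (r powr M * (poly p M)\<^sup>2) \<le> (LINT a|\<mu>. r powr a * (poly p a)\<^sup>2))"

text \<open>Since \<open>falling k a \<le> falling k M\<close> on the support, testing the bound on the polynomial
  \<open>falling k * q\<close> gives its analogue for the \<open>k\<close>-th derivative.\<close>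
lemma polynomial_bound_falling:
  assumes k: "k < n" "real n - 2 < M" "measure_support \<mu> \<subseteq> exponents n \<inter> {0..<M}"
    and bound: "polynomial_bound n c M r" and r: "0 < r"
    and q: "\<forall>i\<ge>n - k. coeff q i = 0"
  shows "c * r powr M * falling k M * (poly q M)\<^sup>2 \<le> (LINT a|\<mu>. falling k a * r powr a * (poly q a)\<^sup>2)"
proof -
  obtain p where p: "degree p \<le> k" "\<forall>a. poly p a = falling k a" using falling_poly by blast
  have "\<forall>i\<ge>n. coeff (p * q) i = 0"
  proof (cases "q = 0")
    case False
    have "degree q < n - k"
      using q False by (metis leading_coeff_neq_0 linorder_not_le)
    then have "degree (p * q) < n" using degree_mult_le[of p q] p(1) by linarith
    then show ?thesis by (auto intro: coeff_eq_0)
  qed simp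
  then have "c * (r powr M * (poly (p * q) M)\<^sup>2) \<le> (LINT a|\<mu>. r powr a * (poly (p * q) a)\<^sup>2)"
    using bound unfolding polynomial_bound_def by blast
  also have "\<dots> = (LINT a|\<mu>. r powr a * (falling k a * poly q a)\<^sup>2)"
    using p(2) by simp
  also have "\<dots> \<le> (LINT a|\<mu>. falling k M * (falling k a * r powr a * (poly q a)\<^sup>2))"
  proof (rule integral_mono_support)
    fix a assume a: "a \<in> measure_support \<mu>"
    then have e: "a \<in> exponents n" "a \<le> M" using k(3) by auto
    have "falling k a * (falling k a * r powr a * (poly q a)\<^sup>2) \<le> falling k M * (falling k a * r powr a * (poly q a)\<^sup>2)"
      using falling_mono[OF e(1) k(1) e(2) k(2)] falling_nonneg[OF e(1) k(1)] by (intro mult_right_mono) auto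
    then show "r powr a * (falling k a * poly q a)\<^sup>2 \<le> falling k M * (falling k a * r powr a * (poly q a)\<^sup>2)"
      by (simp add: power2_eq_square mult_ac)
  qed (use r in \<open>auto intro!: continuous_intros\<close>)
  also have "\<dots> = falling k M * (LINT a|\<mu>. falling k a * r powr a * (poly q a)\<^sup>2)"
    by simp
  finally have "falling k M * (c * r powr M * falling k M * (poly q M)\<^sup>2) \<le>
      falling k M * (LINT a|\<mu>. falling k a * r powr a * (poly q a)\<^sup>2)"
    using p(2) by (simp add: power2_eq_square mult_ac)
  moreover have "0 < falling k M" using k by (intro falling_pos) auto
  ultimately show ?thesis by (rule mult_left_le_imp_le)
qed

text \<open>If \<open>c \<le> 0\<close>, both terms of the form are nonnegative; this alternative
  serves unbounded entries, where no \<open>r\<close> exists. Otherwise this is the extrapolation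
  with weight \<open>falling k a * r powr a\<close> and constant
  \<open>c * r powr M * falling k M\<close>.\<close>

lemma diff_fun_rank_one_nonneg:
  fixes u z :: "nat \<Rightarrow> real"
  assumes k: "k < n" "real n - 2 < M" "measure_support \<mu> \<subseteq> exponents n \<inter> {0..<M}"
    and T: "T \<subseteq> measure_support \<mu>" "finite T" "card T = n"
    and u: "\<And>i. i < n - k \<Longrightarrow> 0 < u i"
    and C: "c \<le> 0 \<or> (\<exists>r>0. (\<forall>i<n - k. u i * u i < r) \<and> polynomial_bound n c M r)"
  shows "0 \<le> (\<Sum>i<n - k. \<Sum>j<n - k. z i * z j * diff_fun c M k (u i * u j))"
proof -
  define g where "g a = (\<Sum>i<n - k. z i * u i powr (a - real k))" for a
  have form: "(\<Sum>i<n - k. \<Sum>j<n - k. z i * z j * diff_fun c M k (u i * u j)) =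
    (LINT a|\<mu>. falling k a * (g a)\<^sup>2) - c * (falling k M * (g M)\<^sup>2)"
    using diff_fun_rank_one_form[where m = "n - k" and u = u, OF u] unfolding g_def by blast
  have fM: "0 < falling k M" using k by (intro falling_pos) auto
  have fa: "0 \<le> falling k a" if "a \<in> measure_support \<mu>" for a
    using falling_nonneg k that by blast
  show ?thesis
  proof (cases "c \<le> 0")
    case True
    have "0 \<le> (LINT a|\<mu>. falling k a * (g a)\<^sup>2)"
      using fa by (intro integral_nonneg_support) simp
    moreover have "c * (falling k M * (g M)\<^sup>2) \<le> 0"
      using True fM by (simp add: mult_nonpos_nonneg)
    ultimately show ?thesis unfolding form by simp
  next
    case False
    then obtain r where r: "0 < r" "\<forall>i<n - k. u i * u i < r" "polynomial_bound n c M r" using C by blast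
    define s where "s = sqrt r"
    have s: "0 < s" "s * s = r" using r by (auto simp: s_def)
    have us: "u i < s" if "i < n - k" for i
      using r(2) that unfolding s_def by (auto intro: real_less_rsqrt simp: power2_eq_square)
    \<comment> \<open>Dividing by \<open>s powr a\<close> turns \<open>u i powr a\<close> into an
      exponential whose frequency is negative because \<open>u i < s\<close>. The shift of the
      exponent by \<open>k\<close> goes into the coefficient \<open>w i\<close>.\<close>
    define \<nu> where "\<nu> i = ln (u i) - ln s" for i
    define w where "w i = z i * u i powr (- real k)" for i
    define L where "L = \<nu> ` {..<n - k}"
    define b where "b l = (\<Sum>i\<in>{i\<in>{..<n - k}. \<nu> i = l}. w i)" for l
    have L: "finite L" "\<forall>l\<in>L. l < 0" "card L \<le> n - k"
      using us u s card_image_le[of "{..<n - k}" \<nu>] by (auto simp: L_def \<nu>_def)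
    have g: "g a = s powr a * exp_poly 0 b L a" for a
    proof -
      have "z i * u i powr (a - real k) = s powr a * (w i * exp (\<nu> i * a))" if "i < n - k" for i
      proof -
        have "u i powr (a - real k) = u i powr (- real k) * u i powr a"
          using u[OF that] by (simp flip: powr_add)
        moreover have "u i powr a = s powr a * exp (\<nu> i * a)"
          using u[OF that] s(1) by (simp add: powr_def \<nu>_def algebra_simps flip: exp_add)
        ultimately show ?thesis by (simp add: w_def)
      qed
      then have "g a = (\<Sum>i<n - k. s powr a * (w i * exp (\<nu> i * a)))"
        unfolding g_def by (intro sum.cong) auto
      then show ?thesis
        unfolding b_def L_def by (simp add: sum_distrib_left[symmetric] exp_poly_image_sum)
    qed
    have g2: "(g a)\<^sup>2 = r powr a * (exp_poly 0 b L a)\<^sup>2" for a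
      using s by (simp add: g power_mult_distrib power2_eq_square flip: powr_mult)
    \<comment> \<open>The weight \<open>falling k\<close> vanishes at 0, ..., k - 1, so at most
      \<open>k\<close> of the \<open>n\<close> points are lost.\<close>
    define T' where "T' = T - real ` {..<k}"
    have T': "finite T'" "T' \<subseteq> measure_support \<mu>" using T by (auto simp: T'_def)
    have Tpos: "0 < falling k t * r powr t" if "t \<in> T'" for t
      using that fa[of t] T'(2) r(1) falling_eq_0_iff[of k t] by (auto simp: T'_def less_le)
    have "n - k \<le> card T'"
      using diff_card_le_card_Diff[of "real ` {..<k}" T] T card_image_le[of "{..<k}" real]
      unfolding T'_def by simp
    then have LT: "card L \<le> card T'" using L(3) by simp
    have "c * r powr M * falling k M * (exp_poly 0 b L M)\<^sup>2 \<le>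
      (LINT a|\<mu>. falling k a * r powr a * (exp_poly 0 b L a)\<^sup>2)"
    proof (rule exp_poly_extrapolation[OF _ _ T' Tpos _ L(1,2) LT])
      show "continuous_on UNIV (\<lambda>a. falling k a * r powr a)"
        using r by (intro continuous_intros) auto
      show "0 \<le> falling k a * r powr a" if "a \<in> measure_support \<mu>" for a
        using fa[OF that] by simp
      show "measure_support \<mu> \<subseteq> {..<M}" using k(3) by auto
      show "c * r powr M * falling k M * (poly q M)\<^sup>2 \<le> (LINT a|\<mu>. falling k a * r powr a * (poly q a)\<^sup>2)"
        if "\<forall>i\<ge>card L. coeff q i = 0" for q
        using polynomial_bound_falling[OF k r(3,1), of q] that L(3) by auto
    qed
    then show ?thesis unfolding form g2 by (simp add: mult_ac)
  qed
qed

text \<open>Lowering the size by one costs one derivative, so size \<open>m\<close> is paired with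
  the derivative of order \<open>n - m\<close>. The induction starts from the empty form and reaches
  the function itself at \<open>m = n\<close>.\<close>

lemma diff_fun_preserves_psd_form:
  assumes n: "real n - 2 < M" "measure_support \<mu> \<subseteq> exponents n \<inter> {0..<M}"
    and T: "T \<subseteq> measure_support \<mu>" "finite T" "card T = n"
    and C: "c \<le> 0 \<or> (\<exists>r>0. (\<forall>x\<in>I. x < r) \<and> polynomial_bound n c M r)"
    and I: "convex I" "\<And>x. x \<in> I \<Longrightarrow> 0 < x" "\<And>x y. x \<in> I \<Longrightarrow> 0 < y \<Longrightarrow> y \<le> x \<Longrightarrow> y \<in> I"
    and "m \<le> n" "psd_form m A" "\<And>i j. i < m \<Longrightarrow> j < m \<Longrightarrow> A i j \<in> I"
  shows "psd_form m (\<lambda>i j. diff_fun c M (n - m) (A i j))"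
  using assms(10-)
proof (induction m arbitrary: A)
  case 0
  then show ?case by (simp add: psd_form_def)
next
  case (Suc m)
  define k where "k = n - Suc m"
  have k: "k < n" "n - m = Suc k" "n - k = Suc m" using Suc.prems(1) by (auto simp: k_def)
  have "psd_form (Suc m) (\<lambda>i j. diff_fun c M k (A i j))"
  proof (rule psd_form_extension[where f = "diff_fun c M k" and f' = "diff_fun c M (Suc k)" and A = A, OF I(1)])
    show "0 < x" if "x \<in> I" for x by (rule I(2)[OF that])
    show "y \<in> I" if "x \<in> I" "0 < y" "y \<le> x" for x y by (rule I(3)[OF that])
    show "(diff_fun c M k has_real_derivative diff_fun c M (Suc k) x) (at x)" if "x \<in> I" for x
      using I(2)[OF that] by (rule DERIV_diff_fun)
    show "0 \<le> (\<Sum>i<Suc m. \<Sum>j<Suc m. z i * z j * diff_fun c M k (u i * u j))"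
      if u: "\<And>i. i \<le> m \<Longrightarrow> 0 < u i" "\<And>i j. i \<le> m \<Longrightarrow> j \<le> m \<Longrightarrow> u i * u j \<in> I" for u z
    proof -
      have "c \<le> 0 \<or> (\<exists>r>0. (\<forall>i<n - k. u i * u i < r) \<and> polynomial_bound n c M r)"
        using C u(2) k(3) by (auto simp: less_Suc_eq_le)
      then show ?thesis
        using diff_fun_rank_one_nonneg[OF k(1) n T, of u c z] u(1) k(3) by (simp only: less_Suc_eq_le)
    qed
    show "psd_form m (\<lambda>i j. diff_fun c M (Suc k) (B i j))"
      if "psd_form m B" "\<And>i j. i < m \<Longrightarrow> j < m \<Longrightarrow> B i j \<in> I" for B
      using Suc.IH[of B] that Suc.prems(1) k(2) by simp
    show "A i j \<in> I" if "i \<le> m" "j \<le> m" for i j using Suc.prems(3) that by simp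
  qed (rule Suc.prems(2))
  then show ?case by (simp add: k_def)
qed

section \<open>Necessity of the bound\<close>

lemma exp_difference_quotient_limit:
  fixes a :: real
  shows "(\<lambda>k. (1 - exp (- inverse (real (Suc k)) * a)) * real (Suc k)) \<longlonglongrightarrow> a"
proof -
  have "((\<lambda>h. exp (- h * a)) has_real_derivative - a) (at 0)"
    by (auto intro!: derivative_eq_intros)
  then have "((\<lambda>h. (exp (- h * a) - 1) / h) \<longlongrightarrow> - a) (at 0)"
    by (simp add: has_field_derivative_iff)
  moreover have "filterlim (\<lambda>k. inverse (real (Suc k))) (at 0) sequentially"
    using LIMSEQ_inverse_real_of_nat by (auto simp: filterlim_at)
  ultimately have "(\<lambda>k. (exp (- inverse (real (Suc k)) * a) - 1) / inverse (real (Suc k))) \<longlonglongrightarrow> - a"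
    by (rule filterlim_compose)
  then have "(\<lambda>k. - ((exp (- inverse (real (Suc k)) * a) - 1) / inverse (real (Suc k)))) \<longlonglongrightarrow> - (- a)"
    by (rule tendsto_minus)
  then show ?thesis by (simp add: divide_inverse algebra_simps)
qed

text \<open>Rank-one matrices with entries \<open>r exp (- \<epsilon> (i + j + 2))\<close>: the functions
  \<open>exp (- \<epsilon> a) p ((1 - exp (- \<epsilon> a)) / \<epsilon>)\<close> are combinations of the exponentials
  \<open>exp (- \<epsilon> (i + 1) a)\<close> and converge to \<open>p a\<close> as \<open>\<epsilon>\<close> tends to 0.\<close>
lemma polynomial_bound_necessary:
  assumes r: "0 < r" and supp: "measure_support \<mu> \<subseteq> {0..<M}"
    and form: "\<And>u z. (\<And>i. i < n \<Longrightarrow> 0 < u i) \<Longrightarrow> (\<And>i j. i < n \<Longrightarrow> j < n \<Longrightarrow> u i * u j < r) \<Longrightarrow>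
      0 \<le> (\<Sum>i<n. \<Sum>j<n. z i * z j * diff_fun c M 0 (u i * u j))"
  shows "polynomial_bound n c M r"
  unfolding polynomial_bound_def
proof (intro allI impI)
  fix p :: "real poly" assume p: "\<forall>i\<ge>n. coeff p i = 0"
  define e where "e k = inverse (real (Suc k))" for k
  have e: "0 < e k" for k by (simp add: e_def)
  define y where "y k a = (1 - exp (- e k * a)) * real (Suc k)" for k a
  define g where "g k a = sqrt r powr a * (exp (- e k * a) * poly p (y k a))" for k a
  have y_lim: "(\<lambda>k. y k a) \<longlonglongrightarrow> a" for a
    using exp_difference_quotient_limit by (simp add: y_def e_def)
  have "e \<longlonglongrightarrow> 0" unfolding e_def by (rule LIMSEQ_inverse_real_of_nat)
  then have exp_lim: "(\<lambda>k. exp (- e k * a)) \<longlonglongrightarrow> 1" for a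
    by (auto intro!: tendsto_eq_intros)
  have "(\<lambda>k. g k a) \<longlonglongrightarrow> sqrt r powr a * (1 * poly p a)" for a
    unfolding g_def by (intro tendsto_intros exp_lim tendsto_poly y_lim)
  then have g_lim: "(\<lambda>k. (g k a)\<^sup>2) \<longlonglongrightarrow> (sqrt r powr a * (1 * poly p a))\<^sup>2" for a
    by (intro tendsto_power)
  have sq: "(sqrt r powr a * x)\<^sup>2 = r powr a * x\<^sup>2" for a x
    using r by (simp add: power_mult_distrib power2_eq_square flip: powr_mult)
  have cont: "continuous_on UNIV (g k)" for k
    unfolding g_def y_def using r by (intro continuous_intros) auto
  have ineq: "c * (g k M)\<^sup>2 \<le> (LINT a|\<mu>. (g k a)\<^sup>2)" for k
  proof -
    \<comment> \<open>\<open>p\<close> composed with \<open>(1 - X) / e k\<close>, so that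
      \<open>poly q (exp (- e k * a))\<close> is \<open>poly p (y k a)\<close>.\<close>
    define q where "q = pcompose p [:real (Suc k), - real (Suc k):]"
    have "degree [:real (Suc k), - real (Suc k):] \<le> 1" by simp
    then have "degree q \<le> degree p * 1"
      unfolding q_def by (metis degree_pcompose mult_le_mono2)
    then have q: "coeff q i = 0" if "n \<le> i" for i
    proof (cases "p = 0")
      case False
      then have "degree p < n" using p by (metis leading_coeff_neq_0 linorder_not_le)
      then show ?thesis using \<open>degree q \<le> degree p * 1\<close> that by (intro coeff_eq_0) simp
    qed (simp add: q_def)
    \<comment> \<open>The exponent uses \<open>Suc i\<close> rather than \<open>i\<close>: this
      keeps all products strictly below \<open>r\<close>, also for \<open>i = j = 0\<close>, and
      produces the extra factor \<open>exp (- e k * a)\<close> in \<open>g\<close>.\<close>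
    define u where "u i = sqrt r * exp (- e k * real (Suc i))" for i
    have u: "0 < u i" for i using r by (simp add: u_def)
    have "u i * u j < r" for i j
    proof -
      have "u i * u j = r * exp (- e k * real (Suc i) + - e k * real (Suc j))"
        unfolding exp_add using r by (simp add: u_def)
      also have "\<dots> < r * 1"
      proof (intro mult_strict_left_mono r)
        have "0 < e k * real (Suc i)" "0 < e k * real (Suc j)" using e[of k] by simp_all
        then show "exp (- e k * real (Suc i) + - e k * real (Suc j)) < 1"
          unfolding exp_less_one_iff by linarith
      qed
      finally show ?thesis by simp
    qed
    then have "0 \<le> (\<Sum>i<n. \<Sum>j<n. coeff q i * coeff q j * diff_fun c M 0 (u i * u j))"
      using u by (intro form)
    then have *: "0 \<le> (LINT a|\<mu>. (\<Sum>i<n. coeff q i * u i powr a)\<^sup>2) - c * (\<Sum>i<n. coeff q i * u i powr M)\<^sup>2"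
      using diff_fun_rank_one_form[where k = 0 and u = u and m = n, OF u] by simp
    have "(\<Sum>i<n. coeff q i * u i powr a) = g k a" for a
    proof -
      have 1: "coeff q i * u i powr a = sqrt r powr a * exp (- e k * a) * (coeff q i * exp (- e k * a) ^ i)" for i
      proof -
        have "ln (u i) = ln (sqrt r) + - e k * real (Suc i)"
          using r unfolding u_def by (subst ln_mult) auto
        then have "u i powr a = exp (a * (ln (sqrt r) + - e k * real (Suc i)))"
          using u[of i] by (simp add: powr_def)
        also have "\<dots> = sqrt r powr a * exp (- e k * a + real i * (- e k * a))"
          using r by (simp add: powr_def algebra_simps flip: exp_add)
        also have "\<dots> = sqrt r powr a * (exp (- e k * a) * exp (- e k * a) ^ i)"
          by (simp only: exp_add exp_of_nat_mult)
        finally show ?thesis by (simp only: mult_ac)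
      qed
      have 2: "poly q x = (\<Sum>i<n. coeff q i * x ^ i)" for x
        using q by (intro poly_eq_sum_lessThan) simp
      have "poly q (exp (- e k * a)) = poly p (y k a)"
        by (simp add: q_def poly_pcompose y_def algebra_simps)
      then show ?thesis by (simp only: 1 2 sum_distrib_left[symmetric] g_def mult.assoc)
    qed
    with * show ?thesis by simp
  qed
  have "(\<lambda>k. LINT a|\<mu>. (g k a)\<^sup>2) \<longlonglongrightarrow> (LINT a|\<mu>. (sqrt r powr a * (1 * poly p a))\<^sup>2)"
  proof -
    have "bounded (poly p ` {0..M})"
      by (intro compact_imp_bounded compact_continuous_image continuous_intros) auto
    then obtain B where B: "\<And>x. x \<in> {0..M} \<Longrightarrow> \<bar>poly p x\<bar> \<le> B" unfolding bounded_iff by fastforce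
    show ?thesis
    proof (rule integral_dominated_convergence[where w = "\<lambda>a. r powr a * B\<^sup>2"])
      show "integrable \<mu> (\<lambda>a. r powr a * B\<^sup>2)" using r by (intro integrable_continuous continuous_intros) auto
      show "(\<lambda>a. (sqrt r powr a * (1 * poly p a))\<^sup>2) \<in> borel_measurable \<mu>"
        using r by (intro measurable_continuous continuous_intros) auto
      show "(\<lambda>a. (g k a)\<^sup>2) \<in> borel_measurable \<mu>" for k
        by (intro measurable_continuous continuous_intros cont)
      show "AE a in \<mu>. (\<lambda>k. (g k a)\<^sup>2) \<longlonglongrightarrow> (sqrt r powr a * (1 * poly p a))\<^sup>2"
        using g_lim by (intro AE_I2)
      show "AE a in \<mu>. norm ((g k a)\<^sup>2) \<le> r powr a * B\<^sup>2" for k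
      proof (rule AE_support)
        fix a assume "a \<in> measure_support \<mu>"
        then have a: "0 \<le> a" "a < M" using supp by auto
        have ea: "0 \<le> e k * a" using e[of k] a by simp
        \<comment> \<open>This gives \<open>0 \<le> y k a \<le> a\<close> on the support, so one
          bound of \<open>p\<close> on \<open>{0..M}\<close> dominates all
          \<open>g k\<close>.\<close>
        have "1 - e k * a \<le> exp (- e k * a)" using exp_ge_add_one_self[of "- e k * a"] by simp
        then have "y k a \<le> e k * a * real (Suc k)" unfolding y_def by (intro mult_right_mono) auto
        also have "\<dots> = a" by (simp add: e_def)
        finally have "y k a \<in> {0..M}" using ea a by (auto simp: y_def)
        then have "\<bar>exp (- e k * a) * poly p (y k a)\<bar> \<le> 1 * B"
          unfolding abs_mult using ea B by (intro mult_mono) auto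
        then have "(exp (- e k * a) * poly p (y k a))\<^sup>2 \<le> B\<^sup>2"
          by (metis abs_ge_zero mult_1 power2_abs power_mono)
        then show "norm ((g k a)\<^sup>2) \<le> r powr a * B\<^sup>2"
          unfolding g_def sq by (simp add: mult_left_mono)
      qed
    qed
  qed
  from LIMSEQ_le[OF tendsto_mult_left[OF g_lim[of M], of c] this] ineq
  show "c * (r powr M * (poly p M)\<^sup>2) \<le> (LINT a|\<mu>. r powr a * (poly p a)\<^sup>2)"
    by (simp add: sq)
qed

text \<open>The integral grows at most like \<open>x powr b\<close> for the largest support point
  \<open>b < M\<close>, so a positive multiple of \<open>x powr M\<close> overtakes it.\<close>

lemma diff_fun_nonneg_imp_nonpos:
  assumes supp: "measure_support \<mu> \<subseteq> {0..<M}" "measure_support \<mu> \<noteq> {}"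
    and nonneg: "\<And>x. 0 < x \<Longrightarrow> 0 \<le> diff_fun c M 0 x"
  shows "c \<le> 0"
proof (rule ccontr)
  assume "\<not> c \<le> 0"
  then have c: "0 < c" by simp
  obtain b where b: "b \<in> measure_support \<mu>" "\<And>a. a \<in> measure_support \<mu> \<Longrightarrow> a \<le> b"
    using compact_attains_sup[OF compact_support supp(2)] by blast
  have bM: "b < M" using b(1) supp(1) by auto
  define m where "m = measure \<mu> UNIV"
  have m: "0 \<le> m" by (simp add: m_def)
  have bound: "c * x powr (M - b) \<le> m" if "1 \<le> x" for x
  proof -
    have "c * x powr M \<le> (LINT a|\<mu>. x powr a)" using nonneg[of x] that by (simp add: diff_fun_def)
    also have "\<dots> \<le> (LINT a|\<mu>. x powr b)"
      using that b(2) by (intro integral_mono_support continuous_intros powr_mono) auto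
    also have "\<dots> = m * x powr b" using sets_eq_imp_space_eq[OF sets_eq_borel] by (simp add: m_def)
    finally have "c * x powr M / x powr b \<le> m" using that by (simp add: divide_le_eq)
    then show ?thesis by (simp add: powr_diff)
  qed
  \<comment> \<open>Makes \<open>c * x powr (M - b)\<close> equal to \<open>m + c\<close>, which
    exceeds the bound \<open>m\<close>.\<close>
  define x where "x = (m / c + 1) powr (1 / (M - b))"
  have "1 \<le> x" unfolding x_def using m c bM by (intro ge_one_powr_ge_zero) auto
  moreover have "x powr (M - b) = m / c + 1" using bM m c by (simp add: x_def powr_powr add_nonneg_pos)
  ultimately have "c * (m / c + 1) \<le> m" using bound by metis
  then show False using c by (simp add: distrib_left)
qed

end

section \<open>The inverse matrix\<close>

lemma scalar_prod_mult_mat_vec: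
  fixes A :: "real mat"
  assumes "A \<in> carrier_mat n n" "v \<in> carrier_vec n" "w \<in> carrier_vec n"
  shows "v \<bullet> (A *\<^sub>v w) = (\<Sum>i<n. \<Sum>j<n. v $ i * w $ j * A $$ (i, j))"
  using assms
  by (auto simp: scalar_prod_def atLeast0LessThan sum_distrib_left mult_ac intro!: sum.cong)

lemma pos_semidef_iff_psd_form:
  assumes A: "A \<in> carrier_mat n n"
  shows "pos_semidef A \<longleftrightarrow> psd_form n (\<lambda>i j. A $$ (i, j))"
proof -
  have sym: "transpose_mat A = A \<longleftrightarrow> (\<forall>i<n. \<forall>j<n. A $$ (i, j) = A $$ (j, i))"
    using A by (auto simp: mat_eq_iff)
  have "(\<forall>v\<in>carrier_vec n. 0 \<le> v \<bullet> (A *\<^sub>v v)) \<longleftrightarrow>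
    (\<forall>z. 0 \<le> (\<Sum>i<n. \<Sum>j<n. z i * z j * A $$ (i, j)))" (is "?l \<longleftrightarrow> ?r")
  proof
    assume l: ?l
    show ?r
    proof
      fix z :: "nat \<Rightarrow> real"
      have "0 \<le> vec n z \<bullet> (A *\<^sub>v vec n z)" using l by simp
      also have "\<dots> = (\<Sum>i<n. \<Sum>j<n. z i * z j * A $$ (i, j))"
        by (simp add: scalar_prod_mult_mat_vec[OF A])
      finally show "0 \<le> (\<Sum>i<n. \<Sum>j<n. z i * z j * A $$ (i, j))" .
    qed
  next
    assume ?r
    then show ?l by (simp add: scalar_prod_mult_mat_vec[OF A])
  qed
  then show ?thesis using A sym unfolding pos_semidef_def psd_form_def by auto
qed

lemma preserves_positivity_iff_psd_form:
  "preserves_positivity n I f \<longleftrightarrow>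
    (\<forall>A. psd_form n A \<longrightarrow> (\<forall>i<n. \<forall>j<n. A i j \<in> I) \<longrightarrow> psd_form n (\<lambda>i j. f (A i j)))"
  (is "_ \<longleftrightarrow> ?r")
proof -
  have cong: "psd_form n A \<longleftrightarrow> psd_form n B" if "\<And>i j. i < n \<Longrightarrow> j < n \<Longrightarrow> A i j = B i j" for A B
    using that by (simp add: psd_form_def)
  have mem: "A \<in> psd_matrices n I \<longleftrightarrow> A \<in> carrier_mat n n \<and> psd_form n (\<lambda>i j. A $$ (i, j)) \<and>
      (\<forall>i<n. \<forall>j<n. A $$ (i, j) \<in> I)" for A
  proof (cases "A \<in> carrier_mat n n")
    case True
    have "elements_mat A \<subseteq> I \<longleftrightarrow> (\<forall>i<n. \<forall>j<n. A $$ (i, j) \<in> I)"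
    proof
      assume "elements_mat A \<subseteq> I"
      then show "\<forall>i<n. \<forall>j<n. A $$ (i, j) \<in> I" using elements_matI[OF True] by blast
    next
      assume *: "\<forall>i<n. \<forall>j<n. A $$ (i, j) \<in> I"
      show "elements_mat A \<subseteq> I"
      proof
        fix x assume "x \<in> elements_mat A"
        then obtain i j where "i < dim_row A" "j < dim_col A" "x = A $$ (i, j)" using elements_matD by blast
        then show "x \<in> I" using * True by simp
      qed
    qed
    then show ?thesis using True pos_semidef_iff_psd_form[OF True] by (simp add: psd_matrices_def)
  qed (simp add: psd_matrices_def)
  have map: "pos_semidef (map_mat f A) \<longleftrightarrow> psd_form n (\<lambda>i j. f (A $$ (i, j)))" if "A \<in> carrier_mat n n" for A
  proof -
    have "map_mat f A \<in> carrier_mat n n" using that by simp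
    then have "pos_semidef (map_mat f A) \<longleftrightarrow> psd_form n (\<lambda>i j. map_mat f A $$ (i, j))"
      by (rule pos_semidef_iff_psd_form)
    also have "\<dots> \<longleftrightarrow> psd_form n (\<lambda>i j. f (A $$ (i, j)))" by (rule cong) (use that in simp)
    finally show ?thesis .
  qed
  show ?thesis
  proof
    assume l: "preserves_positivity n I f"
    show ?r
    proof (intro allI impI)
      fix A assume A: "psd_form n A" "\<forall>i<n. \<forall>j<n. A i j \<in> I"
      let ?A = "mat n n (\<lambda>(i, j). A i j)"
      have "psd_form n (\<lambda>i j. ?A $$ (i, j)) \<longleftrightarrow> psd_form n A" by (rule cong) simp
      then have "?A \<in> psd_matrices n I" unfolding mem using A by simp
      then have "pos_semidef (map_mat f ?A)" using l unfolding preserves_positivity_def by blast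
      moreover have "?A \<in> carrier_mat n n" by simp
      ultimately have "psd_form n (\<lambda>i j. f (?A $$ (i, j)))" using map by blast
      moreover have "psd_form n (\<lambda>i j. f (?A $$ (i, j))) \<longleftrightarrow> psd_form n (\<lambda>i j. f (A i j))"
        by (rule cong) simp
      ultimately show "psd_form n (\<lambda>i j. f (A i j))" by blast
    qed
  next
    assume r: ?r
    show "preserves_positivity n I f" unfolding preserves_positivity_def
    proof
      fix A assume "A \<in> psd_matrices n I"
      then have A: "A \<in> carrier_mat n n" "psd_form n (\<lambda>i j. A $$ (i, j))"
        "\<forall>i<n. \<forall>j<n. A $$ (i, j) \<in> I" unfolding mem by blast+
      then have "psd_form n (\<lambda>i j. f (A $$ (i, j)))" using r by simp
      then show "pos_semidef (map_mat f A)" using map[OF A(1)] by blast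
    qed
  qed
qed

lemma positive_definite_inverse:
  fixes A :: "real mat"
  assumes A: "A \<in> carrier_mat n n" and pd: "\<And>v. v \<in> carrier_vec n \<Longrightarrow> v \<noteq> 0\<^sub>v n \<Longrightarrow> 0 < v \<bullet> (A *\<^sub>v v)"
  obtains B where "mat_inverse A = Some B" "B \<in> carrier_mat n n" "A * B = 1\<^sub>m n"
proof -
  have "det A \<noteq> 0"
  proof
    assume "det A = 0"
    then obtain v where v: "v \<in> carrier_vec n" "v \<noteq> 0\<^sub>v n" "A *\<^sub>v v = 0\<^sub>v n"
      using det_0_iff_vec_prod_zero_field[OF A] by blast
    then show False using pd[of v] by simp
  qed
  then have "A \<in> Units (ring_mat TYPE(real) n ())" by (rule det_non_zero_imp_unit[OF A])
  then obtain B where "mat_inverse A = Some B"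
    using mat_inverse(1)[OF A, where b = "()"] by (cases "mat_inverse A") auto
  then show thesis using mat_inverse(2)[OF A] that by blast
qed

context compact_support_measure
begin

text \<open>\<open>G_mat n \<mu> r\<close> is the Gram matrix of the monomials of degree below
  \<open>n\<close> for the weight \<open>r powr a\<close>.\<close>

lemma G_mat_form:
  assumes "0 < r" "y \<in> carrier_vec n" "z \<in> carrier_vec n"
  shows "y \<bullet> (G_mat n \<mu> r *\<^sub>v z) =
    (LINT a|\<mu>. r powr a * ((\<Sum>i<n. y $ i * a ^ i) * (\<Sum>j<n. z $ j * a ^ j)))"
proof -
  have int: "integrable \<mu> (\<lambda>a. y $ i * z $ j * (r powr a * (a ^ i * a ^ j)))" for i j
    using assms(1) by (intro integrable_continuous continuous_intros) auto
  have "y \<bullet> (G_mat n \<mu> r *\<^sub>v z) = (\<Sum>i<n. \<Sum>j<n. y $ i * z $ j * G_mat n \<mu> r $$ (i, j))"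
    using assms by (intro scalar_prod_mult_mat_vec) (auto simp: G_mat_def)
  also have "\<dots> = (\<Sum>i<n. \<Sum>j<n. LINT a|\<mu>. y $ i * z $ j * (r powr a * (a ^ i * a ^ j)))"
    by (intro sum.cong refl) (simp add: G_mat_def power_vec_def)
  also have "\<dots> = (LINT a|\<mu>. (\<Sum>i<n. \<Sum>j<n. y $ i * z $ j * (r powr a * (a ^ i * a ^ j))))"
    using int by (simp only: Bochner_Integration.integral_sum Bochner_Integration.integrable_sum)
  also have "\<dots> = (LINT a|\<mu>. r powr a * ((\<Sum>i<n. y $ i * a ^ i) * (\<Sum>j<n. z $ j * a ^ j)))"
  proof (intro Bochner_Integration.integral_cong refl)
    fix a
    show "(\<Sum>i<n. \<Sum>j<n. y $ i * z $ j * (r powr a * (a ^ i * a ^ j))) =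
        r powr a * ((\<Sum>i<n. y $ i * a ^ i) * (\<Sum>j<n. z $ j * a ^ j))"
      by (subst sum_product) (simp add: sum_distrib_left mult_ac)
  qed
  finally show ?thesis .
qed

text \<open>The entries of \<open>y\<close>, the inverse matrix applied to
  \<open>power_vec n M\<close>, are the coefficients of the polynomial reproducing evaluation at
  \<open>M\<close>, and \<open>\<kappa>\<close> is both its value at \<open>M\<close> and its
  squared norm. Testing the bound on this polynomial gives one direction, Cauchy-Schwarz the
  other.\<close>

lemma polynomial_bound_iff_inverse:
  assumes n: "0 < n" and r: "0 < r"
    and T: "T \<subseteq> measure_support \<mu>" "finite T" "card T = n"
  shows "polynomial_bound n c M r \<longleftrightarrow>
    c \<le> 1 / (r powr M * (power_vec n M \<bullet> (the (mat_inverse (G_mat n \<mu> r)) *\<^sub>v power_vec n M)))"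
proof -
  let ?G = "G_mat n \<mu> r" and ?v = "power_vec n M"
  define q where "q z a = (\<Sum>i<n. z $ i * a ^ i)" for z :: "real vec" and a
  have G: "?G \<in> carrier_mat n n" and v: "?v \<in> carrier_vec n" by (simp_all add: G_mat_def power_vec_def)
  have cont: "continuous_on UNIV (q z)" for z unfolding q_def by (intro continuous_intros)
  have cont_powr: "continuous_on UNIV (\<lambda>a. r powr a)" using r by (intro continuous_intros) auto
  have form: "y \<bullet> (?G *\<^sub>v z) = (LINT a|\<mu>. r powr a * (q y a * q z a))"
    if "y \<in> carrier_vec n" "z \<in> carrier_vec n" for y z
    using G_mat_form[OF r that] by (simp add: q_def)
  have ev: "z \<bullet> ?v = q z M" if "z \<in> carrier_vec n" for z
    by (simp add: scalar_prod_def power_vec_def q_def atLeast0LessThan)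
  have pd: "0 < z \<bullet> (?G *\<^sub>v z)" if z: "z \<in> carrier_vec n" "z \<noteq> 0\<^sub>v n" for z
  proof -
    have "0 \<le> (LINT a|\<mu>. r powr a * (q z a * q z a))" by (intro integral_nonneg_support) simp
    moreover have "(LINT a|\<mu>. r powr a * (q z a * q z a)) \<noteq> 0"
    proof
      assume 0: "(LINT a|\<mu>. r powr a * (q z a * q z a)) = 0"
      define p where "p = (\<Sum>i<n. monom (z $ i) i)"
      have cp: "coeff p i = (if i < n then z $ i else 0)" for i by (simp add: p_def coeff_sum)
      \<comment> \<open>With no frequencies the zero count is the usual one: a nonzero polynomial of
        degree below \<open>n\<close> cannot vanish at the \<open>n\<close> points of
        \<open>T\<close>.\<close>
      have "exp_poly p (\<lambda>_. 0) {} t = 0" if "t \<in> T" for t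
      proof -
        have "r powr t * (q z t * q z t) = 0"
          using that T(1) r by (intro integral_zero_support[OF _ _ 0]) (auto intro!: continuous_intros cont)
        then show ?thesis using r by (simp add: exp_poly_def p_def poly_sum poly_monom q_def)
      qed
      then have "p = 0" using exp_poly_zeros[of "{}" n p T "\<lambda>_. 0" "{}"] T cp by auto
      then have "z = 0\<^sub>v n" using cp z(1) by (intro eq_vecI) (auto, metis coeff_0)
      then show False using z(2) by simp
    qed
    ultimately show ?thesis unfolding form[OF z(1) z(1)] by linarith
  qed
  obtain B where B: "mat_inverse ?G = Some B" "B \<in> carrier_mat n n" "?G * B = 1\<^sub>m n"
    using positive_definite_inverse[OF G pd] by blast
  define y where "y = B *\<^sub>v ?v"
  have y: "y \<in> carrier_vec n" using B(2) v by (simp add: y_def)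
  have Gy: "?G *\<^sub>v y = ?v"
    using assoc_mult_mat_vec[OF G B(2) v] B(3) v by (simp add: y_def)
  define \<kappa> where "\<kappa> = ?v \<bullet> y"
  have "?v $ 0 = 1" using n by (simp add: power_vec_def)
  then have "?v \<noteq> 0\<^sub>v n" using n by auto
  moreover have "(?G *\<^sub>v 0\<^sub>v n) $ 0 = 0" using n by (simp add: G_mat_def)
  ultimately have "y \<noteq> 0\<^sub>v n" using Gy \<open>?v $ 0 = 1\<close> by auto
  then have \<kappa>: "0 < \<kappa>" "\<kappa> = q y M" "\<kappa> = (LINT a|\<mu>. r powr a * (q y a * q y a))"
    using pd[OF y] form[OF y y] ev[OF y] comm_scalar_prod[OF v y] by (simp_all add: Gy \<kappa>_def)
  have rep: "(LINT a|\<mu>. r powr a * (q y a * q z a)) = q z M" if "z \<in> carrier_vec n" for z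
    using form[OF that y] ev[OF that] by (simp add: Gy mult.commute[of "q z _"])
  have "polynomial_bound n c M r \<longleftrightarrow>
    (\<forall>z\<in>carrier_vec n. c * (r powr M * (q z M)\<^sup>2) \<le> (LINT a|\<mu>. r powr a * (q z a)\<^sup>2))"
    (is "_ \<longleftrightarrow> ?R")
  proof
    assume l: "polynomial_bound n c M r"
    show ?R
    proof
      fix z :: "real vec"
      let ?p = "\<Sum>i<n. monom (z $ i) i"
      have 1: "poly ?p a = q z a" for a by (simp add: q_def poly_sum poly_monom)
      have 2: "\<forall>i\<ge>n. coeff ?p i = 0" by (simp add: coeff_sum)
      show "c * (r powr M * (q z M)\<^sup>2) \<le> (LINT a|\<mu>. r powr a * (q z a)\<^sup>2)"
        using mp[OF spec[OF l[unfolded polynomial_bound_def], of ?p] 2] unfolding 1 .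
    qed
  next
    assume R: ?R
    show "polynomial_bound n c M r" unfolding polynomial_bound_def
    proof (intro allI impI)
      fix p :: "real poly" assume p: "\<forall>i\<ge>n. coeff p i = 0"
      have "poly p a = q (vec n (coeff p)) a" for a
        by (simp add: q_def poly_eq_sum_lessThan[OF p])
      then show "c * (r powr M * (poly p M)\<^sup>2) \<le> (LINT a|\<mu>. r powr a * (poly p a)\<^sup>2)"
        using R by simp
    qed
  qed
  also have "\<dots> \<longleftrightarrow> c \<le> 1 / (r powr M * \<kappa>)"
  proof
    assume R: ?R
    have "c * (r powr M * \<kappa>\<^sup>2) \<le> \<kappa>"
      using bspec[OF R y] unfolding \<kappa>(2)[symmetric] power2_eq_square[of "q y _"] \<kappa>(3)[symmetric] .
    then have "\<kappa> * (c * (r powr M * \<kappa>)) \<le> \<kappa> * 1" by (simp add: power2_eq_square mult_ac)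
    then have "c * (r powr M * \<kappa>) \<le> 1" using \<kappa>(1) by (rule mult_left_le_imp_le)
    then show "c \<le> 1 / (r powr M * \<kappa>)" using \<kappa>(1) r by (simp add: pos_le_divide_eq)
  next
    assume "c \<le> 1 / (r powr M * \<kappa>)"
    then have c: "c * (r powr M * \<kappa>) \<le> 1" using \<kappa>(1) r by (simp add: pos_le_divide_eq)
    show ?R
    proof
      fix z :: "real vec" assume z: "z \<in> carrier_vec n"
      let ?J = "LINT a|\<mu>. r powr a * (q z a)\<^sup>2"
      have J: "0 \<le> ?J" by (intro integral_nonneg_support) simp
      have CS: "(q z M)\<^sup>2 \<le> \<kappa> * ?J"
        using weighted_Cauchy_Schwarz[OF cont_powr _ cont cont, of y z] rep[OF z] \<kappa> by simp
      show "c * (r powr M * (q z M)\<^sup>2) \<le> ?J"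
      proof (cases "c \<le> 0")
        case True
        then have "c * (r powr M * (q z M)\<^sup>2) \<le> 0" by (simp add: mult_nonpos_nonneg)
        then show ?thesis using J by linarith
      next
        case False
        then have "c * (r powr M * (q z M)\<^sup>2) \<le> c * (r powr M * (\<kappa> * ?J))"
          using CS by (intro mult_left_mono) auto
        also have "\<dots> = (c * (r powr M * \<kappa>)) * ?J" by simp
        also have "\<dots> \<le> 1 * ?J" using c J by (rule mult_right_mono)
        finally show ?thesis by simp
      qed
    qed
  qed
  finally show ?thesis by (simp add: B(1) \<kappa>_def y_def)
qed

end

section \<open>The sharp threshold for positivity preservation\<close>

theorem corollary6p4:
  fixes \<rho> :: ereal and n :: nat and M c :: real and \<mu> :: "real measure"
  assumes "0 < \<rho>"
    and "2 \<le> n"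
    and "real n - 2 < M"
    and "finite_measure \<mu>"
    and "sets \<mu> = sets borel"
    and "compact (measure_support \<mu>)"
    and "measure_support \<mu> \<subseteq> exponents n \<inter> {0..<M}"
    and "\<exists>T \<subseteq> measure_support \<mu>. finite T \<and> card T = n"
  shows "preserves_positivity n {x. 0 < x \<and> ereal x < \<rho>} (\<lambda>x. F_fun \<mu> x - c * x powr M)
           \<longleftrightarrow> c \<le> c_star n \<mu> M \<rho>"
proof -
  interpret compact_support_measure \<mu>
    by (intro compact_support_measure.intro compact_support_measure_axioms.intro assms)
  obtain T where T: "T \<subseteq> measure_support \<mu>" "finite T" "card T = n" using assms(8) by blast
  define I where "I = {x. 0 < x \<and> ereal x < \<rho>}"
  have down: "y \<in> I" if "x \<in> I" "0 < y" "y \<le> x" for x y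
    using that le_less_trans[of "ereal y" "ereal x" \<rho>] by (simp add: I_def)
  have pos: "0 < x" if "x \<in> I" for x using that by (simp add: I_def)
  have "is_interval I"
    unfolding is_interval_1 using down pos by (meson less_le_trans)
  then have "convex I" by (rule is_interval_convex)
  note I = this pos down
  have supp: "measure_support \<mu> \<subseteq> {0..<M}" "measure_support \<mu> \<noteq> {}"
    using assms(2,7) T by auto
  have f: "diff_fun c M 0 = (\<lambda>x. F_fun \<mu> x - c * x powr M)"
    by (simp add: diff_fun_def F_fun_def fun_eq_iff)
  have suff: "preserves_positivity n I (diff_fun c M 0)"
    if "c \<le> 0 \<or> (\<exists>r>0. (\<forall>x\<in>I. x < r) \<and> polynomial_bound n c M r)"
    using diff_fun_preserves_psd_form[OF assms(3,7) T that I order.refl]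
    by (simp add: preserves_positivity_iff_psd_form)
  have form: "0 \<le> (\<Sum>i<n. \<Sum>j<n. z i * z j * diff_fun c M 0 (u i * u j))"
    if "preserves_positivity n I (diff_fun c M 0)" "\<And>i j. i < n \<Longrightarrow> j < n \<Longrightarrow> u i * u j \<in> I" for u z
  proof -
    have "psd_form n (\<lambda>i j. diff_fun c M 0 (u i * u j))"
      using that psd_form_rank_one[of n u] unfolding preserves_positivity_iff_psd_form by blast
    then show ?thesis unfolding psd_form_def by blast
  qed
  have "preserves_positivity n I (diff_fun c M 0) \<longleftrightarrow> c \<le> c_star n \<mu> M \<rho>"
  proof (cases "\<rho> = \<infinity>")
    case True
    have "c \<le> 0" if pres: "preserves_positivity n I (diff_fun c M 0)"
    proof (rule diff_fun_nonneg_imp_nonpos[OF supp])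
      fix x :: real assume x: "0 < x"
      \<comment> \<open>For infinite \<open>\<rho>\<close> the constant matrix with entry
        \<open>x\<close> is an admissible test for every \<open>x > 0\<close>, and a diagonal entry
        of its image yields the nonnegativity of the function at \<open>x\<close>.\<close>
      have "psd_form n (\<lambda>i j. diff_fun c M 0 (sqrt x * sqrt x))"
        using pres psd_form_rank_one[of n "\<lambda>_. sqrt x"] x True
        unfolding preserves_positivity_iff_psd_form by (simp add: I_def)
      then show "0 \<le> diff_fun c M 0 x"
        using psd_form_diag[of n _ 0] assms(2) x by fastforce
    qed
    then show ?thesis using suff True by (auto simp: c_star_def)
  next
    case False
    then obtain r where r: "\<rho> = ereal r" "0 < r" using assms(1) by (cases \<rho>) auto
    have "preserves_positivity n I (diff_fun c M 0) \<longleftrightarrow> polynomial_bound n c M r"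
    proof
      assume pres: "preserves_positivity n I (diff_fun c M 0)"
      show "polynomial_bound n c M r"
        using form[OF pres] r by (intro polynomial_bound_necessary[OF r(2) supp(1)]) (simp add: I_def)
    next
      assume "polynomial_bound n c M r"
      then show "preserves_positivity n I (diff_fun c M 0)"
        using r by (intro suff disjI2 exI[of _ r]) (simp add: I_def)
    qed
    then show ?thesis
      using polynomial_bound_iff_inverse[OF _ r(2) T] assms(2) r
      by (simp add: c_star_def Let_def)
  qed
  then show ?thesis by (simp add: f I_def)
qed

end
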